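(* For every $s\in\mathbb R$ there exists a constant $C_s>0$ depending only on $s$ such that, for every $h>0$ and every $v\in\dot B^s_h$, $$\|v\|_{\dot h^s_h}\le C_s\,\|v\|_{\dot B^s_h}.$$ Moreover, in the case $s=\frac12$, there is a universal constant $C>0$ such that, for every $h>0$ and every $v\in\dot B^{1/2}_h$, $$\|v\|_{\ell^\infty_h}\le C\,\|v\|_{\dot B^{1/2}_h}.$$
   Context: Let $h>0$. For a sequence $v=(v_n)_{n\in\mathbb Z}$ put $\|v\|_{\ell^2_h}^2:=h\sum_{n\in\mathbb Z}|v_n|^2$ and $\|v\|_{\ell^\infty_h}:=\sup_{n\in\mathbb Z}|v_n|$; $\ell^2_h$ is the set of sequences with $\|v\|_{\ell^2_h}<\infty$. The discrete Fourier transform of $v\in\ell^2_h$ is $\hat v(\xi)=\frac{h}{\sqrt{2\pi}}\sum_{n\in\mathbb Z}e^{-i\xi nh}v_n$, $\xi\in[-\frac\pi h,\frac\pi h]$ (an isometry from $\ell^2_h$ onto $L^2([-\frac\pi h,\frac\pi h])$), with inverse $(\mathcal F^{-1}g)_n=\frac1{\sqrt{2\pi}}\int_{-\pi/h}^{\pi/h}e^{i\xi nh}g(\xi)\,d\xi$. Dyadic decomposition: for $j\in\mathbb Z$ let $F_h(j):=\{\xi\in[-\frac\pi h,\frac\pi h]:\ |\frac{\sin(\xi h)}{h}|\in[\frac34 2^j,\frac43 2^{j+1}]\}$. Fix a family of measurable functions $\varphi_j:[-\frac\pi h,\frac\pi h]\to[0,1]$, $j\in\mathbb Z$ (depending on $h$),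 with $\mathrm{supp}(\varphi_j)\subseteq F_h(j)$ for all $j$ and $\sum_{j\in\mathbb Z}\varphi_j(\xi)=1$ for all $\xi\in[-\frac\pi h,\frac\pi h]$ with $\sin(\xi h)\ne0$. The localization operators are $\delta_h^jv:=\mathcal F^{-1}(\hat v\,\varphi_j)$ for $v\in\ell^2_h$. For $s\in\mathbb R$, the discrete Besov space $\dot B^s_h$ consists of all $v\in\ell^2_h$ with $\|v\|_{\dot B^s_h}:=\sum_{j\in\mathbb Z}2^{js}\|\delta_h^jv\|_{\ell^2_h}<\infty$. The homogeneous discrete Sobolev norm is $\|v\|_{\dot h^s_h}:=\big\|\hat v(\xi)\,\big|\tfrac{\sin(\xi h)}{h}\big|^s\big\|_{L^2(-\frac\pi h,\frac\pi h)}$. *)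

theory Defs
  imports "HOL-Analysis.Analysis"
begin

text \<open>All norms take values in \<^typ>\<open>ennreal\<close> and may be infinite. Sequences indexed by the integers are functions
  \<^typ>\<open>int \<Rightarrow> complex\<close>; functions on the frequency interval are functions on \<^typ>\<open>real\<close> whose
  values outside the interval are irrelevant.\<close>

definition sqrt_ennreal :: "ennreal \<Rightarrow> ennreal" where
  "sqrt_ennreal x = (if x = \<infinity> then \<infinity> else ennreal (sqrt (enn2real x)))"

definition l2_norm :: "real \<Rightarrow> (int \<Rightarrow> complex) \<Rightarrow> ennreal" where
  "l2_norm h v = sqrt_ennreal (ennreal h * (\<Sum>\<^sub>\<infinity>n. ennreal ((cmod (v n))\<^sup>2)))"

definition linf_norm :: "(int \<Rightarrow> complex) \<Rightarrow> ennreal" where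
  "linf_norm v = (SUP n. ennreal (cmod (v n)))"

definition l2_space :: "real \<Rightarrow> (int \<Rightarrow> complex) set" where
  "l2_space h = {v. l2_norm h v < \<infinity>}"

definition freq :: "real \<Rightarrow> real set" where
  "freq h = {-(pi / h)..pi / h}"

abbreviation freq_measure :: "real \<Rightarrow> real measure" where
  "freq_measure h \<equiv> lebesgue_on (freq h)"

definition L2_norm :: "real \<Rightarrow> (real \<Rightarrow> complex) \<Rightarrow> ennreal" where
  "L2_norm h g = sqrt_ennreal (\<integral>\<^sup>+\<xi>. ennreal ((cmod (g \<xi>))\<^sup>2) \<partial>freq_measure h)"

definition dft_partial :: "real \<Rightarrow> (int \<Rightarrow> complex) \<Rightarrow> nat \<Rightarrow> real \<Rightarrow> complex" where
  "dft_partial h v N \<xi> =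
     complex_of_real (h / sqrt (2 * pi)) *
     (\<Sum>n\<in>{-int N..int N}. exp (- \<i> * complex_of_real (\<xi> * real_of_int n * h)) * v n)"

text \<open>For square-summable sequences the Fourier series need not converge absolutely, so the
  transform is the limit of the partial sums in the \<open>L\<^sup>2\<close> sense. It is determined only up
  to null sets; \<open>dft\<close> picks a representative. Everything below depends on \<open>dft h v\<close> only
  through Lebesgue integrals and hence not on this choice.\<close>

definition is_dft :: "real \<Rightarrow> (int \<Rightarrow> complex) \<Rightarrow> (real \<Rightarrow> complex) \<Rightarrow> bool" where
  "is_dft h v g \<longleftrightarrow>
     g \<in> borel_measurable (freq_measure h) \<and>
     L2_norm h g < \<infinity> \<and>
     (\<lambda>N. L2_norm h (\<lambda>\<xi>. g \<xi> - dft_partial h v N \<xi>)) \<longlonglongrightarrow> 0"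

definition dft :: "real \<Rightarrow> (int \<Rightarrow> complex) \<Rightarrow> real \<Rightarrow> complex" where
  "dft h v = (SOME g. is_dft h v g)"

definition inverse_dft :: "real \<Rightarrow> (real \<Rightarrow> complex) \<Rightarrow> int \<Rightarrow> complex" where
  "inverse_dft h g n =
     complex_of_real (1 / sqrt (2 * pi)) *
     (LINT \<xi>|freq_measure h. exp (\<i> * complex_of_real (\<xi> * real_of_int n * h)) * g \<xi>)"

definition dyadic_shell :: "real \<Rightarrow> int \<Rightarrow> real set" where
  "dyadic_shell h j =
     {\<xi> \<in> freq h. \<bar>sin (\<xi> * h) / h\<bar> \<in> {3 / 4 * 2 powi j..4 / 3 * 2 powi (j + 1)}}"

definition dyadic_partition :: "real \<Rightarrow> (int \<Rightarrow> real \<Rightarrow> real) \<Rightarrow> bool" where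
  "dyadic_partition h \<phi> \<longleftrightarrow>
     (\<forall>j. \<phi> j \<in> borel_measurable (freq_measure h) \<and>
          (\<forall>\<xi>\<in>freq h. \<phi> j \<xi> \<in> {0..1}) \<and>
          closure {\<xi> \<in> freq h. \<phi> j \<xi> \<noteq> 0} \<subseteq> dyadic_shell h j) \<and>
     (\<forall>\<xi>\<in>freq h. sin (\<xi> * h) \<noteq> 0 \<longrightarrow> ((\<lambda>j. \<phi> j \<xi>) has_sum 1) UNIV)"

definition localization ::
    "real \<Rightarrow> (int \<Rightarrow> real \<Rightarrow> real) \<Rightarrow> int \<Rightarrow> (int \<Rightarrow> complex) \<Rightarrow> int \<Rightarrow> complex" where
  "localization h \<phi> j v = inverse_dft h (\<lambda>\<xi>. dft h v \<xi> * complex_of_real (\<phi> j \<xi>))"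

definition besov_norm ::
    "real \<Rightarrow> (int \<Rightarrow> real \<Rightarrow> real) \<Rightarrow> real \<Rightarrow> (int \<Rightarrow> complex) \<Rightarrow> ennreal" where
  "besov_norm h \<phi> s v =
     (\<Sum>\<^sub>\<infinity>j. ennreal (2 powr (real_of_int j * s)) * l2_norm h (localization h \<phi> j v))"

definition besov_space ::
    "real \<Rightarrow> (int \<Rightarrow> real \<Rightarrow> real) \<Rightarrow> real \<Rightarrow> (int \<Rightarrow> complex) set" where
  "besov_space h \<phi> s = {v \<in> l2_space h. besov_norm h \<phi> s v < \<infinity>}"

text \<open>At the finitely many zeros of \<open>sin (\<xi> * h)\<close> the library convention \<open>0 powr s = 0\<close> applies;
  this is a null set and does not affect the norm.\<close>

definition sobolev_norm :: "real \<Rightarrow> real \<Rightarrow> (int \<Rightarrow> complex) \<Rightarrow> ennreal" where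
  "sobolev_norm h s v =
     L2_norm h (\<lambda>\<xi>. dft h v \<xi> * complex_of_real (\<bar>sin (\<xi> * h) / h\<bar> powr s))"

end

theory Submission
  imports Defs
begin

text \<open>
  The transform of \<open>v\<close> splits almost everywhere as the sum over \<open>j\<close> of its products with
  \<open>\<phi> j\<close>. On the support of \<open>\<phi> j\<close> the weight \<open>\<bar>sin (\<xi> * h) / h\<bar> powr s\<close> is
  comparable to \<open>2 powr (j * s)\<close>, so Minkowski's inequality for the sum gives the Sobolev bound. For
  the supremum bound, \<open>v n\<close> is at most the \<open>L\<^sup>1\<close> norm of its transform; the support of
  \<open>\<phi> j\<close> has measure of order \<open>2 powi j\<close>, independently of \<open>h\<close>, so the Cauchy-Schwarz
  inequality bounds the \<open>L\<^sup>1\<close> norm of the \<open>j\<close>-th piece by a multiple of \<open>2 powr (j / 2)\<close>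
  times its \<open>L\<^sup>2\<close> norm.

  Both bounds need the inequality between the \<open>L\<^sup>2\<close> norm of a function and the \<open>\<ell>\<^sup>2\<close> norm of its
  Fourier coefficients in the direction that rests on completeness of the trigonometric system.
  Riesz-Fischer provides a function with the same coefficients as the given one, and the two agree
  almost everywhere: a function with vanishing coefficients is orthogonal to trigonometric
  polynomials, by Stone-Weierstrass to continuous periodic functions, and by dominated convergence
  to all bounded measurable functions, in particular to the signs of its own real and imaginary
  parts.
\<close>

subsection \<open>Completeness of the space of square-integrable functions\<close>

lemma sqrt_ennreal_power2 [simp]: "(sqrt_ennreal x)\<^sup>2 = x"
  by (cases x) (auto simp: sqrt_ennreal_def ennreal_power)

lemma sqrt_ennreal_of_power2 [simp]: "sqrt_ennreal (x\<^sup>2) = x"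
  by (cases x) (auto simp: sqrt_ennreal_def ennreal_power)

text \<open>Squares of norms are plain integrals, so norm inequalities are proved in squared form
  and brought back by this equivalence.\<close>

lemma power2_le_iff_ennreal: "x\<^sup>2 \<le> y\<^sup>2 \<longleftrightarrow> x \<le> (y :: ennreal)"
  by (cases x; cases y) (auto simp: ennreal_power power2_eq_square[of top] ennreal_top_mult top_unique)

lemma sqrt_ennreal_le_iff: "sqrt_ennreal x \<le> y \<longleftrightarrow> x \<le> y\<^sup>2"
  using power2_le_iff_ennreal[of "sqrt_ennreal x" y] by simp

lemma sqrt_ennreal_mono: "x \<le> y \<Longrightarrow> sqrt_ennreal x \<le> sqrt_ennreal y"
  by (simp add: sqrt_ennreal_le_iff)

lemma sqrt_ennreal_mult: "sqrt_ennreal (x * y) = sqrt_ennreal x * sqrt_ennreal y"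
  by (metis power_mult_distrib sqrt_ennreal_of_power2 sqrt_ennreal_power2)

lemma sqrt_ennreal_ennreal: "0 \<le> x \<Longrightarrow> sqrt_ennreal (ennreal x) = ennreal (sqrt x)"
  by (simp add: sqrt_ennreal_def)

lemma sqrt_ennreal_less_top_iff [simp]: "sqrt_ennreal x < top \<longleftrightarrow> x < top"
  by (cases x) (auto simp: sqrt_ennreal_def)

text \<open>Taking extended nonnegative integrands lets infinite sums of absolute values be normed
  without convergence conditions.\<close>

definition eL2 :: "'a measure \<Rightarrow> ('a \<Rightarrow> ennreal) \<Rightarrow> ennreal" where
  "eL2 M f = sqrt_ennreal (\<integral>\<^sup>+x. (f x)\<^sup>2 \<partial>M)"

lemma L2_norm_eq_eL2: "L2_norm h g = eL2 (freq_measure h) (\<lambda>\<xi>. ennreal (cmod (g \<xi>)))"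
  by (simp add: L2_norm_def eL2_def ennreal_power)

lemma eL2_power2: "(eL2 M f)\<^sup>2 = (\<integral>\<^sup>+x. (f x)\<^sup>2 \<partial>M)"
  by (simp add: eL2_def)

lemma eL2_mono_AE: "(AE x in M. f x \<le> g x) \<Longrightarrow> eL2 M f \<le> eL2 M g"
  unfolding eL2_def by (intro sqrt_ennreal_mono nn_integral_mono_AE) (auto simp: power_mono)

lemma eL2_mono: "(\<And>x. x \<in> space M \<Longrightarrow> f x \<le> g x) \<Longrightarrow> eL2 M f \<le> eL2 M g"
  by (intro eL2_mono_AE) auto

lemma eL2_cmult:
  "f \<in> borel_measurable M \<Longrightarrow> eL2 M (\<lambda>x. c * f x) = c * eL2 M f"
  by (simp add: eL2_def power_mult_distrib nn_integral_cmult sqrt_ennreal_mult)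

lemma Cauchy_Schwarz_eL2:
  assumes "f \<in> borel_measurable M" "g \<in> borel_measurable M"
  shows "(\<integral>\<^sup>+x. f x * g x \<partial>M) \<le> eL2 M f * eL2 M g"
  using Cauchy_Schwarz_nn_integral[OF assms]
  by (subst power2_le_iff_ennreal[symmetric]) (simp only: power_mult_distrib eL2_power2)

lemma suminf_power2_ennreal:
  "(\<Sum>i. a i)\<^sup>2 = (\<Sum>i. \<Sum>j. a i * a j :: ennreal)"
  by (simp add: power2_eq_square ennreal_suminf_cmult ennreal_suminf_multc)

text \<open>Minkowski's inequality for countable sums. The square of the sum expands into a double
  series of nonnegative terms, which integrates term by term; Cauchy-Schwarz bounds each cross term,
  and the resulting double series is again a square.\<close>

lemma eL2_suminf_le:
  assumes [measurable]: "\<And>i. f i \<in> borel_measurable M"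
  shows "eL2 M (\<lambda>x. \<Sum>i. f i x) \<le> (\<Sum>i. eL2 M (f i))"
proof -
  have "(eL2 M (\<lambda>x. \<Sum>i. f i x))\<^sup>2 = (\<integral>\<^sup>+x. (\<Sum>i. \<Sum>j. f i x * f j x) \<partial>M)"
    by (simp only: eL2_power2 suminf_power2_ennreal)
  also have "\<dots> = (\<Sum>i. \<Sum>j. \<integral>\<^sup>+x. f i x * f j x \<partial>M)"
    by (subst nn_integral_suminf, measurable, subst nn_integral_suminf, measurable)
  also have "\<dots> \<le> (\<Sum>i. \<Sum>j. eL2 M (f i) * eL2 M (f j))"
    by (intro suminf_le Cauchy_Schwarz_eL2 assms summableI)
  also have "\<dots> = (\<Sum>i. eL2 M (f i))\<^sup>2"
    by (simp only: suminf_power2_ennreal)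
  finally show ?thesis
    by (simp only: power2_le_iff_ennreal)
qed

lemma eL2_add_le:
  assumes [measurable]: "f \<in> borel_measurable M" "g \<in> borel_measurable M"
  shows "eL2 M (\<lambda>x. f x + g x) \<le> eL2 M f + eL2 M g"
proof -
  \<comment> \<open>Padding with zeros turns the binary sum into a series.\<close>
  define F where "F i = (if i = 0 then f else if i = 1 then g else (\<lambda>_. 0))" for i :: nat
  have "(\<Sum>i. F i x) = f x + g x" for x
    by (subst suminf_finite[of "{0,1}"]) (auto simp: F_def)
  moreover have "(\<Sum>i. eL2 M (F i)) = eL2 M f + eL2 M g"
    by (subst suminf_finite[of "{0,1}"]) (auto simp: F_def eL2_def sqrt_ennreal_def)
  ultimately show ?thesis
    using eL2_suminf_le[of F M] by (simp add: F_def)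
qed

lemma eL2_less_top_imp_AE:
  assumes [measurable]: "f \<in> borel_measurable M" and "eL2 M f < \<infinity>"
  shows "AE x in M. f x < \<infinity>"
proof -
  have "(\<integral>\<^sup>+x. (f x)\<^sup>2 \<partial>M) \<noteq> \<infinity>"
    using assms(2) by (auto simp: eL2_def)
  then have "AE x in M. (f x)\<^sup>2 \<noteq> \<infinity>"
    by (intro nn_integral_PInf_AE) auto
  then show ?thesis
    by eventually_elim (simp add: power_eq_top_ennreal top.not_eq_extremum)
qed

text \<open>A subsequence with geometrically small increments has an absolutely convergent
  telescoping series almost everywhere, by Minkowski. Fatou's lemma then shows that the whole
  sequence converges in norm to the pointwise limit.\<close>

theorem L2_complete:
  fixes f :: "nat \<Rightarrow> 'a \<Rightarrow> 'b :: {banach, second_countable_topology}"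
  assumes meas [measurable]: "\<And>n. f n \<in> borel_measurable M"
    and Cauchy: "\<And>e::real. e > 0 \<Longrightarrow>
      \<exists>N. \<forall>m\<ge>N. \<forall>n\<ge>N. eL2 M (\<lambda>x. ennreal (norm (f m x - f n x))) \<le> ennreal e"
  shows "\<exists>g\<in>borel_measurable M. (\<lambda>n. eL2 M (\<lambda>x. ennreal (norm (g x - f n x)))) \<longlonglongrightarrow> 0"
proof -
  have "\<exists>N. \<forall>m\<ge>N. \<forall>n\<ge>N. eL2 M (\<lambda>x. ennreal (norm (f m x - f n x))) \<le> ennreal ((1/2)^k)" for k :: nat
    by (rule Cauchy) simp
  then obtain N where N: "\<And>k m n. m \<ge> N k \<Longrightarrow> n \<ge> N k \<Longrightarrow>
      eL2 M (\<lambda>x. ennreal (norm (f m x - f n x))) \<le> ennreal ((1/2)^k)"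
    by metis
  \<comment> \<open>Partial sums make the indices monotone while keeping \<open>r k\<close> above
    \<open>N k\<close>.\<close>
  define r where "r k = (\<Sum>i\<le>k. N i)" for k
  have rN: "N k \<le> r k" for k
    unfolding r_def by (intro member_le_sum) auto
  have r_mono: "r k \<le> r l" if "k \<le> l" for k l
    unfolding r_def using that by (intro sum_mono2) auto
  define D where "D x = (\<Sum>k. ennreal (norm (f (r (Suc k)) x - f (r k) x)))" for x
  have [measurable]: "D \<in> borel_measurable M"
    unfolding D_def by measurable
  have "eL2 M D \<le> (\<Sum>k. eL2 M (\<lambda>x. ennreal (norm (f (r (Suc k)) x - f (r k) x))))"
    unfolding D_def by (rule eL2_suminf_le) auto
  also have "\<dots> \<le> (\<Sum>k. ennreal ((1/2)^k))"
    by (intro suminf_le N order_trans[OF rN] r_mono summableI) auto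
  also have "\<dots> = ennreal (\<Sum>k. (1/2)^k)"
    by (intro suminf_ennreal2) (auto intro: summable_geometric)
  also have "\<dots> < \<infinity>" by simp
  finally have D: "AE x in M. D x < \<infinity>"
    by (intro eL2_less_top_imp_AE) auto
  \<comment> \<open>Where the subsequence diverges, \<open>lim\<close> takes an unspecified value;
    this happens only on a null set.\<close>
  define g where "g x = lim (\<lambda>k. f (r k) x)" for x
  have [measurable]: "g \<in> borel_measurable M"
    unfolding g_def by measurable
  have lim: "AE x in M. (\<lambda>k. f (r k) x) \<longlonglongrightarrow> g x"
    using D
  proof eventually_elim
    case (elim x)
    then have "summable (\<lambda>k. norm (f (r (Suc k)) x - f (r k) x))"
      by (intro summable_suminf_not_top) (auto simp: D_def)
    then have "summable (\<lambda>k. f (r (Suc k)) x - f (r k) x)"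
      by (rule summable_norm_cancel)
    then have "convergent (\<lambda>k. f (r k) x - f (r 0) x)"
      by (simp only: summable_iff_convergent sum_lessThan_telescope[of "\<lambda>k. f (r k) x"])
    then have "convergent (\<lambda>k. f (r k) x)"
      by (simp add: convergent_diff_const_right_iff)
    then show ?case
      by (simp add: g_def convergent_LIMSEQ_iff)
  qed
  \<comment> \<open>Fatou's lemma along the subsequence: for \<open>k\<close> at least
    \<open>K\<close>, both \<open>r k\<close> and \<open>n\<close> are beyond
    \<open>N K\<close>.\<close>
  have bound: "eL2 M (\<lambda>x. ennreal (norm (g x - f n x))) \<le> ennreal ((1/2)^K)" if n: "n \<ge> r K" for n K
  proof -
    have "(eL2 M (\<lambda>x. ennreal (norm (g x - f n x))))\<^sup>2 =
       (\<integral>\<^sup>+x. liminf (\<lambda>k. (ennreal (norm (f (r k) x - f n x)))\<^sup>2) \<partial>M)"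
      unfolding eL2_power2
    proof (intro nn_integral_cong_AE, use lim in eventually_elim)
      case (elim x)
      then have "(\<lambda>k. ennreal ((norm (f (r k) x - f n x))\<^sup>2)) \<longlonglongrightarrow> ennreal ((norm (g x - f n x))\<^sup>2)"
        by (intro tendsto_intros)
      then have "liminf (\<lambda>k. ennreal ((norm (f (r k) x - f n x))\<^sup>2)) = ennreal ((norm (g x - f n x))\<^sup>2)"
        by (intro lim_imp_Liminf) auto
      then show ?case
        by (simp add: ennreal_power)
    qed
    also have "\<dots> \<le> liminf (\<lambda>k. \<integral>\<^sup>+x. (ennreal (norm (f (r k) x - f n x)))\<^sup>2 \<partial>M)"
      by (intro nn_integral_liminf) auto
    also have "\<dots> \<le> (ennreal ((1/2)^K))\<^sup>2"
    proof (rule Liminf_le)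
      have "eL2 M (\<lambda>x. ennreal (norm (f (r k) x - f n x))) \<le> ennreal ((1/2)^K)" if "k \<ge> K" for k
        using that n r_mono[OF that] rN[of K] by (intro N) auto
      then show "\<forall>\<^sub>F k in sequentially. (\<integral>\<^sup>+x. (ennreal (norm (f (r k) x - f n x)))\<^sup>2 \<partial>M) \<le> (ennreal ((1/2)^K))\<^sup>2"
        unfolding eL2_power2[symmetric] power2_le_iff_ennreal by (rule eventually_sequentiallyI)
    qed simp
    finally show ?thesis by (simp only: power2_le_iff_ennreal)
  qed
  have "(\<lambda>n. eL2 M (\<lambda>x. ennreal (norm (g x - f n x)))) \<longlonglongrightarrow> 0"
  proof (rule order_tendstoI)
    fix a :: ennreal assume "0 < a"
    then obtain b where b: "0 < b" "b < a"
      using dense by blast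
    then obtain e :: real where e: "0 < e" "ennreal e < a"
      by (cases b) auto
    then obtain K where "(1/2)^K < e"
      using real_arch_pow_inv[of e "1/2"] by auto
    with e have "ennreal ((1/2)^K) < a"
      by (meson ennreal_leI less_imp_le order.strict_trans1)
    then show "\<forall>\<^sub>F n in sequentially. eL2 M (\<lambda>x. ennreal (norm (g x - f n x))) < a"
      by (intro eventually_sequentiallyI[of "r K"] order.strict_trans1[OF bound])
  qed auto
  moreover have "g \<in> borel_measurable M"
    by measurable
  ultimately show ?thesis by blast
qed

subsection \<open>The discrete Fourier transform\<close>

definition harmonic :: "real \<Rightarrow> int \<Rightarrow> real \<Rightarrow> complex" where
  "harmonic h n \<xi> = cis (\<xi> * real_of_int n * h)"

lemma harmonic_mult: "harmonic h m \<xi> * harmonic h n \<xi> = harmonic h (m + n) \<xi>"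
  by (simp add: harmonic_def cis_mult algebra_simps)

lemma harmonic_diff: "harmonic h (m - n) \<xi> = harmonic h m \<xi> * harmonic h (- n) \<xi>"
  by (simp add: harmonic_mult)

lemma cnj_harmonic: "cnj (harmonic h n \<xi>) = harmonic h (- n) \<xi>"
  by (simp add: harmonic_def cis_cnj)

lemma norm_harmonic [simp]: "cmod (harmonic h n \<xi>) = 1"
  by (simp add: harmonic_def)

lemma harmonic_0 [simp]: "harmonic h 0 \<xi> = 1"
  by (simp add: harmonic_def)

lemma continuous_on_harmonic [continuous_intros]: "continuous_on A (harmonic h n)"
  unfolding harmonic_def[abs_def] cis_conv_exp by (intro continuous_intros)

lemma dft_partial_eq:
  "dft_partial h v N \<xi> =
     complex_of_real (h / sqrt (2 * pi)) * (\<Sum>n\<in>{-int N..int N}. harmonic h (- n) \<xi> * v n)"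
  by (simp add: dft_partial_def harmonic_def cis_conv_exp)

lemma inverse_dft_eq:
  "inverse_dft h g n = complex_of_real (1 / sqrt (2 * pi)) *
     (LINT \<xi>|freq_measure h. harmonic h n \<xi> * g \<xi>)"
  by (simp add: inverse_dft_def harmonic_def cis_conv_exp)

lemma freq_lebesgue [measurable, simp]: "freq h \<in> sets lebesgue"
  by (simp add: freq_def)

lemma continuous_imp_measurable_freq:
  "continuous_on (freq h) f \<Longrightarrow> f \<in> borel_measurable (freq_measure h)"
  by (rule continuous_imp_measurable_on_sets_lebesgue) simp_all

lemma harmonic_measurable [measurable]: "harmonic h n \<in> borel_measurable (freq_measure h)"
  by (intro continuous_imp_measurable_freq continuous_intros)

lemma dft_partial_measurable [measurable]: "dft_partial h v N \<in> borel_measurable (freq_measure h)"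
  unfolding dft_partial_eq[abs_def] by measurable

lemma emeasure_freq: "0 < h \<Longrightarrow> emeasure (freq_measure h) (freq h) = ennreal (2 * pi / h)"
  by (simp add: emeasure_restrict_space) (simp add: freq_def)

lemma eL2_freq_1:
  assumes "0 < h"
  shows "eL2 (freq_measure h) (\<lambda>_. 1) = ennreal (sqrt (2 * pi / h))"
  using emeasure_freq[OF assms] assms
  by (simp add: eL2_def sqrt_ennreal_ennreal)

lemma continuous_imp_integrable_freq:
  fixes f :: "real \<Rightarrow> complex"
  shows "continuous_on (freq h) f \<Longrightarrow> integrable (freq_measure h) f"
  unfolding freq_def by (rule continuous_imp_integrable_real)

lemma integrable_harmonic_mult:
  assumes "integrable (freq_measure h) k"
  shows "integrable (freq_measure h) (\<lambda>\<xi>. harmonic h n \<xi> * k \<xi>)"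
proof (rule Bochner_Integration.integrable_bound[OF assms])
  have [measurable]: "k \<in> borel_measurable (freq_measure h)"
    using assms by simp
  show "(\<lambda>\<xi>. harmonic h n \<xi> * k \<xi>) \<in> borel_measurable (freq_measure h)"
    by measurable
qed (simp add: norm_mult)

text \<open>Cauchy-Schwarz against the constant 1 on an interval of length
  \<open>2 * pi / h\<close>. It makes square-integrable functions integrable, so their Fourier
  coefficients are genuine integrals.\<close>

lemma nn_integral_le_L2_norm:
  assumes "0 < h" and [measurable]: "g \<in> borel_measurable (freq_measure h)"
  shows "(\<integral>\<^sup>+\<xi>. ennreal (cmod (g \<xi>)) \<partial>freq_measure h) \<le> ennreal (sqrt (2 * pi / h)) * L2_norm h g"
  using Cauchy_Schwarz_eL2[of "\<lambda>_. 1" "freq_measure h" "\<lambda>\<xi>. ennreal (cmod (g \<xi>))"]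
  by (simp add: eL2_freq_1[OF assms(1)] L2_norm_eq_eL2)

lemma L2_imp_integrable:
  assumes "0 < h" "g \<in> borel_measurable (freq_measure h)" "L2_norm h g < \<infinity>"
  shows "integrable (freq_measure h) g"
  using nn_integral_le_L2_norm[OF assms(1,2)] assms(2,3)
  by (simp add: integrable_iff_bounded ennreal_mult_less_top le_less_trans)

section \<open>Orthogonality of the characters and norms of trigonometric polynomials\<close>

lemma integral_harmonic:
  assumes "0 < h"
  shows "(LINT \<xi>|freq_measure h. harmonic h n \<xi>) = (if n = 0 then complex_of_real (2 * pi / h) else 0)"
proof (cases "n = 0")
  case True
  then show ?thesis
    using emeasure_freq[OF assms] assms by (simp add: measure_def scaleR_conv_of_real)
next
  case False
  have "((harmonic h n) has_integral
      harmonic h n (pi / h) / (\<i> * (n * h)) - harmonic h n (- (pi / h)) / (\<i> * (n * h))) {-(pi / h)..pi / h}"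
  proof (rule fundamental_theorem_of_calculus)
    fix x
    show "((\<lambda>x. harmonic h n x / (\<i> * (n * h))) has_vector_derivative harmonic h n x) (at x within {-(pi / h)..pi / h})"
    proof -
      \<comment> \<open>The antiderivative is differentiated along the complex variable and then
        restricted to the real axis.\<close>
      have "((\<lambda>z. exp (\<i> * (z * n * h)) / (\<i> * (n * h))) has_field_derivative exp (\<i> * (complex_of_real x * n * h)))
          (at (complex_of_real x))"
        using False assms by (auto intro!: derivative_eq_intros simp: mult_ac simp flip: mult.assoc[of \<i> \<i>])
      from has_vector_derivative_real_field[OF this] show ?thesis
        by (simp add: harmonic_def[abs_def] cis_conv_exp)
    qed
  qed (use assms in \<open>auto simp: field_simps\<close>)
  \<comment> \<open>At the endpoints the angles are \<open>n * pi\<close> and its negative: the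
    sines vanish and the cosine is even.\<close>
  moreover have "harmonic h n (pi / h) = harmonic h n (- (pi / h))"
    using assms by (simp add: harmonic_def cis.code sin_int_times_real)
  ultimately have "integral (freq h) (harmonic h n) = 0"
    by (simp add: freq_def integral_unique)
  then show ?thesis
    using False by (simp add: lebesgue_integral_eq_integral continuous_imp_integrable_freq continuous_on_harmonic)
qed

text \<open>The squared modulus is the polynomial times its conjugate; in the resulting double sum
  orthogonality leaves only the diagonal.\<close>

lemma nn_integral_trig_polynomial:
  assumes "0 < h" "finite A"
  shows "(\<integral>\<^sup>+\<xi>. ennreal ((cmod (\<Sum>n\<in>A. harmonic h (- n) \<xi> * c n))\<^sup>2) \<partial>freq_measure h)
    = ennreal (2 * pi / h * (\<Sum>n\<in>A. (cmod (c n))\<^sup>2))"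
proof -
  let ?M = "freq_measure h"
  let ?p = "\<lambda>\<xi>. \<Sum>n\<in>A. harmonic h (- n) \<xi> * c n"
  have int_h: "integrable ?M (\<lambda>\<xi>. harmonic h k \<xi> * d)" for k d
    by (intro continuous_imp_integrable_freq continuous_intros)
  have "complex_of_real (LINT \<xi>|?M. (cmod (?p \<xi>))\<^sup>2) = (LINT \<xi>|?M. ?p \<xi> * cnj (?p \<xi>))"
    by (subst integral_complex_of_real[symmetric]) (simp only: complex_norm_square)
  also have "\<dots> = (LINT \<xi>|?M. (\<Sum>n\<in>A. \<Sum>m\<in>A. harmonic h (m - n) \<xi> * (c n * cnj (c m))))"
    by (simp only: sum_product cnj_sum complex_cnj_mult cnj_harmonic minus_minus harmonic_diff mult_ac)
  also have "\<dots> = (\<Sum>n\<in>A. \<Sum>m\<in>A. (LINT \<xi>|?M. harmonic h (m - n) \<xi> * (c n * cnj (c m))))"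
    by (intro Bochner_Integration.integral_sum Bochner_Integration.integrable_sum int_h
        trans[OF Bochner_Integration.integral_sum] sum.cong refl)
  also have "\<dots> = (\<Sum>n\<in>A. \<Sum>m\<in>A. if m = n then complex_of_real (2 * pi / h) * (c n * cnj (c m)) else 0)"
    by (intro sum.cong refl) (simp add: integral_harmonic[OF assms(1)])
  also have "\<dots> = (\<Sum>n\<in>A. complex_of_real (2 * pi / h) * (c n * cnj (c n)))"
    using assms(2) by (intro sum.cong refl) (simp add: sum.delta)
  also have "\<dots> = complex_of_real (2 * pi / h * (\<Sum>n\<in>A. (cmod (c n))\<^sup>2))"
    by (simp add: sum_distrib_left flip: complex_norm_square)
  finally have "(LINT \<xi>|?M. (cmod (?p \<xi>))\<^sup>2) = 2 * pi / h * (\<Sum>n\<in>A. (cmod (c n))\<^sup>2)"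
    using of_real_eq_iff by blast
  moreover have "integrable ?M (\<lambda>\<xi>. (cmod (?p \<xi>))\<^sup>2)"
    unfolding freq_def by (intro continuous_imp_integrable_real continuous_intros)
  ultimately show ?thesis
    by (subst nn_integral_eq_integral) auto
qed

lemma L2_norm_trig_polynomial:
  assumes "0 < h" "finite A"
  shows "(L2_norm h (\<lambda>\<xi>. complex_of_real (h / sqrt (2 * pi)) * (\<Sum>n\<in>A. harmonic h (- n) \<xi> * v n)))\<^sup>2
    = ennreal (h * (\<Sum>n\<in>A. (cmod (v n))\<^sup>2))"
proof -
  have "(L2_norm h (\<lambda>\<xi>. complex_of_real (h / sqrt (2 * pi)) * (\<Sum>n\<in>A. harmonic h (- n) \<xi> * v n)))\<^sup>2 =
    (\<integral>\<^sup>+\<xi>. ennreal (h\<^sup>2 / (2 * pi)) * ennreal ((cmod (\<Sum>n\<in>A. harmonic h (- n) \<xi> * v n))\<^sup>2) \<partial>freq_measure h)"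
    using assms(1) by (simp add: L2_norm_def norm_mult norm_divide power_mult_distrib power_divide
        flip: ennreal_mult)
  also have "\<dots> = ennreal (h\<^sup>2 / (2 * pi)) * ennreal (2 * pi / h * (\<Sum>n\<in>A. (cmod (v n))\<^sup>2))"
    by (simp add: nn_integral_cmult nn_integral_trig_polynomial[OF assms])
  also have "\<dots> = ennreal (h * (\<Sum>n\<in>A. (cmod (v n))\<^sup>2))"
    using assms(1) by (simp add: sum_nonneg power2_eq_square flip: ennreal_mult)
  finally show ?thesis .
qed

section \<open>Existence of the transform of a square-summable sequence\<close>

lemma l2_norm_power2: "(l2_norm h v)\<^sup>2 = ennreal h * (\<Sum>\<^sub>\<infinity>n. ennreal ((cmod (v n))\<^sup>2))"
  by (simp add: l2_norm_def)

lemma l2_space_imp_summable: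
  assumes "0 < h" "v \<in> l2_space h"
  shows "(\<lambda>n. (cmod (v n))\<^sup>2) summable_on UNIV"
proof (rule nonneg_bdd_above_summable_on)
  let ?S = "\<Sum>\<^sub>\<infinity>n. ennreal ((cmod (v n))\<^sup>2)"
  have "ennreal h * ?S < top"
    using assms by (simp add: l2_space_def l2_norm_def)
  then have "?S < top"
    using assms by (auto simp: ennreal_mult_less_top)
  then obtain S where S: "?S = ennreal S" "0 \<le> S"
    by (cases ?S) auto
  have "sum (\<lambda>n. (cmod (v n))\<^sup>2) F \<le> S" if "finite F" for F
  proof -
    have "ennreal (\<Sum>n\<in>F. (cmod (v n))\<^sup>2) \<le> ?S"
      using that by (subst nonneg_infsum_complete) (auto intro!: SUP_upper2[of F] simp flip: sum_ennreal)
    then show ?thesis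
      using S by (simp add: sum_nonneg)
  qed
  then show "bdd_above (sum (\<lambda>n. (cmod (v n))\<^sup>2) ` {F. F \<subseteq> UNIV \<and> finite F})"
    by (auto simp: bdd_above_def)
qed auto

text \<open>A finite set \<open>F\<close> captures the total up to \<open>e\<close>, and
  \<open>N\<close> is chosen so that the symmetric range contains \<open>F\<close>. A set
  \<open>A\<close> outside the range is disjoint from \<open>F\<close>, so its sum fits into the
  remaining \<open>e\<close>.\<close>

lemma summable_on_int_tail:
  fixes f :: "int \<Rightarrow> real"
  assumes "f summable_on UNIV" "\<And>n. 0 \<le> f n" "0 < e"
  shows "\<exists>N::nat. \<forall>A. finite A \<longrightarrow> A \<inter> {-int N..int N} = {} \<longrightarrow> sum f A \<le> e"
proof -
  have le: "sum f F \<le> infsum f UNIV" if "finite F" for F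
    using assms that by (intro finite_sum_le_infsum) auto
  have "\<forall>\<^sub>F F in finite_subsets_at_top UNIV. dist (sum f F) (infsum f UNIV) < e"
    using assms(1,3) has_sum_infsum tendstoD unfolding has_sum_def by blast
  then obtain F where F: "finite F" "dist (sum f F) (infsum f UNIV) < e"
    by (auto simp: eventually_finite_subsets_at_top)
  have "bdd_above ((\<lambda>n. nat \<bar>n\<bar>) ` F)" using F by simp
  then obtain N where N: "\<And>n. n \<in> F \<Longrightarrow> nat \<bar>n\<bar> \<le> N"
    by (auto simp: bdd_above_def)
  then have FN: "F \<subseteq> {-int N..int N}"
    by fastforce
  have "sum f A \<le> e" if A: "finite A" "A \<inter> {-int N..int N} = {}" for A
  proof -
    have "sum f A + sum f F = sum f (A \<union> F)"
      using A FN F by (intro sum.union_disjoint[symmetric]) auto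
    also have "\<dots> \<le> infsum f UNIV"
      using A F by (intro le) auto
    finally show ?thesis
      using F(2) le[OF F(1)] by (simp add: dist_real_def)
  qed
  then show ?thesis by blast
qed

lemma dft_partial_diff:
  assumes "M \<le> N"
  shows "dft_partial h v N \<xi> - dft_partial h v M \<xi> =
    complex_of_real (h / sqrt (2 * pi)) *
      (\<Sum>n\<in>{-int N..int N} - {-int M..int M}. harmonic h (- n) \<xi> * v n)"
proof -
  have "(\<Sum>n\<in>{-int N..int N}. harmonic h (- n) \<xi> * v n) =
      (\<Sum>n\<in>{-int N..int N} - {-int M..int M}. harmonic h (- n) \<xi> * v n)
      + (\<Sum>n\<in>{-int M..int M}. harmonic h (- n) \<xi> * v n)"
    using assms by (intro sum.subset_diff) auto
  then show ?thesis
    unfolding dft_partial_eq by (simp add: algebra_simps)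
qed

text \<open>Differences of partial sums have norms given by tails of the square sum, so the partial
  sums are Cauchy and completeness supplies a limit. Its norm is finite by the triangle inequality
  with a single partial sum.\<close>

lemma ex_dft:
  assumes h: "0 < h" and v: "v \<in> l2_space h"
  shows "\<exists>g. is_dft h v g"
proof -
  let ?M = "freq_measure h"
  let ?f = "dft_partial h v"
  have Cauchy: "\<exists>N. \<forall>m\<ge>N. \<forall>n\<ge>N. eL2 ?M (\<lambda>x. ennreal (norm (?f m x - ?f n x))) \<le> ennreal e"
    if e: "0 < e" for e :: real
  proof -
    \<comment> \<open>The bound \<open>e\<^sup>2 / h\<close> absorbs the factor \<open>h\<close> in
      the squared norm of a trigonometric polynomial.\<close>
    obtain N :: nat where N: "\<And>A. finite A \<Longrightarrow> A \<inter> {-int N..int N} = {} \<Longrightarrow>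
        (\<Sum>n\<in>A. (cmod (v n))\<^sup>2) \<le> e\<^sup>2 / h"
      using summable_on_int_tail[OF l2_space_imp_summable[OF assms], of "e\<^sup>2 / h"] e h by auto
    have *: "eL2 ?M (\<lambda>x. ennreal (norm (?f n x - ?f m x))) \<le> ennreal e" if "N \<le> m" "m \<le> n" for m n
    proof -
      have "(eL2 ?M (\<lambda>x. ennreal (norm (?f n x - ?f m x))))\<^sup>2 =
          ennreal (h * (\<Sum>n\<in>{-int n..int n} - {-int m..int m}. (cmod (v n))\<^sup>2))"
        unfolding dft_partial_diff[OF that(2)] L2_norm_eq_eL2[symmetric]
        by (rule L2_norm_trig_polynomial[OF h]) simp
      also have "\<dots> \<le> ennreal (h * (e\<^sup>2 / h))"
        using h that by (intro ennreal_leI mult_left_mono N) auto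
      also have "\<dots> = (ennreal e)\<^sup>2"
        using h e by (simp add: ennreal_power)
      finally show ?thesis by (simp only: power2_le_iff_ennreal)
    qed
    have "eL2 ?M (\<lambda>x. ennreal (norm (?f m x - ?f n x))) \<le> ennreal e" if "N \<le> m" "N \<le> n" for m n
    proof (cases "m \<le> n")
      case True
      then show ?thesis using *[of m n] that by (simp add: norm_minus_commute)
    next
      case False
      then show ?thesis using *[of n m] that by simp
    qed
    then show ?thesis by blast
  qed
  obtain g where g [measurable]: "g \<in> borel_measurable ?M"
    and lim: "(\<lambda>n. eL2 ?M (\<lambda>x. ennreal (norm (g x - ?f n x)))) \<longlonglongrightarrow> 0"
    using L2_complete[of ?f ?M, OF dft_partial_measurable Cauchy] by blast
  have "\<forall>\<^sub>F n in sequentially. eL2 ?M (\<lambda>x. ennreal (norm (g x - ?f n x))) < 1"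
    using lim by (rule order_tendstoD) simp
  then obtain n where n: "eL2 ?M (\<lambda>x. ennreal (norm (g x - ?f n x))) < 1"
    by (auto simp: eventually_sequentially)
  have "eL2 ?M (\<lambda>x. ennreal (norm (g x))) \<le>
      eL2 ?M (\<lambda>x. ennreal (norm (g x - ?f n x)) + ennreal (norm (?f n x)))"
    by (intro eL2_mono) (auto simp flip: ennreal_plus intro!: ennreal_leI norm_triangle_sub simp: add.commute)
  also have "\<dots> \<le> eL2 ?M (\<lambda>x. ennreal (norm (g x - ?f n x))) + eL2 ?M (\<lambda>x. ennreal (norm (?f n x)))"
    by (intro eL2_add_le) auto
  also have "\<dots> < \<infinity>"
  proof -
    have "(eL2 ?M (\<lambda>x. ennreal (norm (?f n x))))\<^sup>2 < top"
      unfolding dft_partial_eq L2_norm_eq_eL2[symmetric] L2_norm_trig_polynomial[OF h finite_atLeastAtMost_int]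
      by simp
    then show ?thesis
      using n by (auto simp: power_less_top_ennreal intro: less_trans)
  qed
  finally show ?thesis
    using g lim unfolding is_dft_def L2_norm_eq_eL2 by blast
qed

lemma is_dft_dft: "0 < h \<Longrightarrow> v \<in> l2_space h \<Longrightarrow> is_dft h v (dft h v)"
  using someI_ex[OF ex_dft] by (simp add: dft_def)

section \<open>Fourier inversion\<close>

lemma inverse_dft_dft_partial:
  assumes "0 < h" "\<bar>n\<bar> \<le> int N"
  shows "inverse_dft h (dft_partial h v N) n = v n"
proof -
  have "(LINT \<xi>|freq_measure h. harmonic h n \<xi> * dft_partial h v N \<xi>) =
    (LINT \<xi>|freq_measure h. (\<Sum>m\<in>{-int N..int N}. harmonic h (n - m) \<xi> * (complex_of_real (h / sqrt (2 * pi)) * v m)))"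
    unfolding dft_partial_eq
    by (simp only: sum_distrib_left harmonic_diff mult_ac)
  also have "\<dots> = (\<Sum>m\<in>{-int N..int N}. LINT \<xi>|freq_measure h. harmonic h (n - m) \<xi> * (complex_of_real (h / sqrt (2 * pi)) * v m))"
    by (intro Bochner_Integration.integral_sum continuous_imp_integrable_freq continuous_intros)
  \<comment> \<open>Orthogonality selects \<open>m = n\<close>, an index that lies in the range
    because \<open>N\<close> bounds the modulus of \<open>n\<close>.\<close>
  also have "\<dots> = (\<Sum>m\<in>{-int N..int N}. if m = n then complex_of_real (2 * pi / h) * (complex_of_real (h / sqrt (2 * pi)) * v m) else 0)"
    by (intro sum.cong refl) (simp add: integral_harmonic[OF assms(1)])
  also have "\<dots> = complex_of_real (2 * pi / h * (h / sqrt (2 * pi))) * v n"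
    using assms(2) by (subst sum.delta) auto
  finally have "inverse_dft h (dft_partial h v N) n =
      complex_of_real (1 / sqrt (2 * pi) * (2 * pi / h * (h / sqrt (2 * pi)))) * v n"
    unfolding inverse_dft_eq by (simp only: of_real_mult mult_ac)
  also have "1 / sqrt (2 * pi) * (2 * pi / h * (h / sqrt (2 * pi))) = 1"
    using assms(1) by (simp add: field_simps real_sqrt_mult_self)
  finally show ?thesis by simp
qed

lemma norm_inverse_dft_le:
  "ennreal (cmod (inverse_dft h g n)) \<le> (\<integral>\<^sup>+\<xi>. ennreal (cmod (g \<xi>)) \<partial>freq_measure h)"
proof -
  let ?I = "LINT \<xi>|freq_measure h. harmonic h n \<xi> * g \<xi>"
  have "1 / sqrt (2 * pi) \<le> 1"
    using pi_ge_two by (simp add: field_simps)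
  then have "cmod (inverse_dft h g n) \<le> cmod ?I"
    unfolding inverse_dft_eq norm_mult norm_of_real by (intro mult_left_le_one_le) auto
  then have "ennreal (cmod (inverse_dft h g n)) \<le> ennreal (cmod ?I)"
    by (rule ennreal_leI)
  also have "\<dots> \<le> (\<integral>\<^sup>+\<xi>. ennreal (cmod (harmonic h n \<xi> * g \<xi>)) \<partial>freq_measure h)"
    \<comment> \<open>A non-integrable integrand has integral 0 by convention, which makes the bound
      trivial in that case.\<close>
    by (cases "integrable (freq_measure h) (\<lambda>\<xi>. harmonic h n \<xi> * g \<xi>)")
       (auto intro: integral_norm_bound_ennreal simp: not_integrable_integral_eq)
  finally show ?thesis
    by (simp add: norm_mult)
qed

lemma inverse_dft_diff:
  assumes "integrable (freq_measure h) f" "integrable (freq_measure h) g"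
  shows "inverse_dft h (\<lambda>\<xi>. f \<xi> - g \<xi>) n = inverse_dft h f n - inverse_dft h g n"
  using assms[THEN integrable_harmonic_mult, of n]
  by (simp add: inverse_dft_eq ring_distribs diff_divide_distrib)

text \<open>For large \<open>N\<close> the partial sum already has \<open>n\<close>-th coefficient
  \<open>v n\<close>. Coefficients depend continuously on the function in the mean-square norm, so
  the identity survives the limit.\<close>

lemma inverse_dft_is_dft:
  assumes h: "0 < h" and g: "is_dft h v g"
  shows "inverse_dft h g = v"
proof
  fix n
  let ?M = "freq_measure h"
  have gm [measurable]: "g \<in> borel_measurable ?M" and gL: "L2_norm h g < \<infinity>"
    and lim: "(\<lambda>N. L2_norm h (\<lambda>\<xi>. g \<xi> - dft_partial h v N \<xi>)) \<longlonglongrightarrow> 0"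
    using g by (auto simp: is_dft_def)
  have int_p: "integrable ?M (dft_partial h v N)" for N
    unfolding dft_partial_eq[abs_def] by (intro continuous_imp_integrable_freq continuous_intros)
  have "ennreal (cmod (inverse_dft h g n - v n)) \<le>
      ennreal (sqrt (2 * pi / h)) * L2_norm h (\<lambda>\<xi>. g \<xi> - dft_partial h v N \<xi>)" if "N \<ge> nat \<bar>n\<bar>" for N
  proof -
    have "inverse_dft h g n - v n = inverse_dft h (\<lambda>\<xi>. g \<xi> - dft_partial h v N \<xi>) n"
      using that inverse_dft_dft_partial[OF h, of n N v]
      by (simp add: inverse_dft_diff int_p L2_imp_integrable[OF h gm gL])
    then show ?thesis
      using order_trans[OF norm_inverse_dft_le nn_integral_le_L2_norm[OF h]] by simp
  qed
  moreover have "(\<lambda>N. ennreal (sqrt (2 * pi / h)) * L2_norm h (\<lambda>\<xi>. g \<xi> - dft_partial h v N \<xi>)) \<longlonglongrightarrow> ennreal (sqrt (2 * pi / h)) * 0"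
    by (intro ennreal_tendsto_cmult lim) simp
  ultimately have "ennreal (cmod (inverse_dft h g n - v n)) \<le> ennreal (sqrt (2 * pi / h)) * 0"
    by (intro tendsto_lowerbound[where F = sequentially]) (auto intro: eventually_sequentiallyI)
  then show "inverse_dft h g n = v n"
    by (simp add: ennreal_eq_0_iff)
qed

subsection \<open>Completeness of the trigonometric system\<close>

text \<open>The integrals are the values of \<open>inverse_dft h k\<close> without the constant
  factor. Integrability is included so that they cannot vanish merely by the default value of an
  undefined integral.\<close>

definition null_coeffs :: "real \<Rightarrow> (real \<Rightarrow> complex) \<Rightarrow> bool" where
  "null_coeffs h k \<longleftrightarrow> integrable (freq_measure h) k \<and>
     (\<forall>n. (LINT \<xi>|freq_measure h. harmonic h n \<xi> * k \<xi>) = 0)"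

lemma null_coeffs_add:
  "null_coeffs h k \<Longrightarrow> null_coeffs h l \<Longrightarrow> null_coeffs h (\<lambda>\<xi>. k \<xi> + l \<xi>)"
  by (simp add: null_coeffs_def ring_distribs integrable_harmonic_mult)

lemma null_coeffs_cmult: "null_coeffs h k \<Longrightarrow> null_coeffs h (\<lambda>\<xi>. c * k \<xi>)"
  by (simp add: null_coeffs_def mult.left_commute[of _ c])

text \<open>Multiplication by a character only shifts the index of the coefficients.\<close>

lemma null_coeffs_harmonic:
  "null_coeffs h k \<Longrightarrow> null_coeffs h (\<lambda>\<xi>. harmonic h m \<xi> * k \<xi>)"
  by (simp add: null_coeffs_def integrable_harmonic_mult harmonic_mult flip: mult.assoc)

lemma bounded_linear_complex_real:
  fixes f :: "complex \<Rightarrow> real"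
  assumes "bounded_linear f"
  shows "f z = Re z * f 1 + Im z * f \<i>"
proof -
  interpret bounded_linear f by fact
  have "f z = f (Re z *\<^sub>R 1 + Im z *\<^sub>R \<i>)"
    by (intro arg_cong[of _ _ f]) (simp add: complex_eq_iff)
  then show ?thesis
    by (simp add: add scaleR)
qed

text \<open>On the unit circle a real polynomial in the two coordinates is a trigonometric
  polynomial, and the vanishing of all coefficients is stable under multiplication by those.\<close>

lemma null_coeffs_polynomial:
  assumes "real_polynomial_function p" "null_coeffs h k"
  shows "null_coeffs h (\<lambda>\<xi>. complex_of_real (p (harmonic h 1 \<xi>)) * k \<xi>)"
  using assms
proof (induction arbitrary: k)
  case (linear f)
  \<comment> \<open>With \<open>x\<close> and \<open>y\<close> the real and imaginary parts of
    \<open>z\<close>, these are the coefficients of \<open>z\<close> and \<open>cnj z\<close> in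
    \<open>x * f 1 + y * f \<i>\<close>; on the circle \<open>cnj z\<close> is the character of
    index -1.\<close>
  define a where "a = (complex_of_real (f 1) - \<i> * f \<i>) / 2"
  define b where "b = (complex_of_real (f 1) + \<i> * f \<i>) / 2"
  have "complex_of_real (f (harmonic h 1 \<xi>)) = a * harmonic h 1 \<xi> + b * harmonic h (-1) \<xi>" for \<xi>
    unfolding bounded_linear_complex_real[OF linear(1), of "harmonic h 1 \<xi>"]
    by (simp add: a_def b_def harmonic_def complex_eq_iff field_simps)
  then have "(\<lambda>\<xi>. complex_of_real (f (harmonic h 1 \<xi>)) * k \<xi>) =
      (\<lambda>\<xi>. a * (harmonic h 1 \<xi> * k \<xi>) + b * (harmonic h (-1) \<xi> * k \<xi>))"
    by (simp add: fun_eq_iff algebra_simps)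
  then show ?case
    using linear by (simp only: null_coeffs_add null_coeffs_cmult null_coeffs_harmonic)
next
  case (const c)
  then show ?case by (rule null_coeffs_cmult)
next
  case (add f g)
  then show ?case
    by (simp add: ring_distribs null_coeffs_add)
next
  \<comment> \<open>Generality in \<open>k\<close> matters here: the hypothesis for \<open>f\<close>
    is applied to the product of \<open>g\<close> with \<open>k\<close>.\<close>
  case (mult f g)
  then show ?case
    by (simp add: mult.assoc)
qed

lemma integrable_bounded_mult:
  fixes u :: "'a \<Rightarrow> real" and k :: "'a \<Rightarrow> complex"
  assumes k: "integrable M k" and [measurable]: "u \<in> borel_measurable M"
    and B: "\<And>x. x \<in> space M \<Longrightarrow> \<bar>u x\<bar> \<le> B"
  shows "integrable M (\<lambda>x. complex_of_real (u x) * k x)"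
proof (rule Bochner_Integration.integrable_bound[where f = "\<lambda>x. B * norm (k x)"])
  have [measurable]: "k \<in> borel_measurable M"
    using k by simp
  show "(\<lambda>x. complex_of_real (u x) * k x) \<in> borel_measurable M"
    by measurable
  show "AE x in M. norm (complex_of_real (u x) * k x) \<le> norm (B * norm (k x))"
    using B by (intro AE_I2) (force simp: norm_mult intro!: mult_right_mono)
qed (use k in simp)

text \<open>Stone-Weierstrass gives a polynomial uniformly within \<open>e\<close> of
  \<open>G\<close>. Its integral against \<open>k\<close> vanishes, so the integral for
  \<open>G\<close> is at most \<open>e\<close> times the integral of the modulus of
  \<open>k\<close>, for every positive \<open>e\<close>.\<close>

lemma null_coeffs_continuous_on_circle:
  fixes G :: "complex \<Rightarrow> real"
  assumes k: "null_coeffs h k" and G: "continuous_on (harmonic h 1 ` freq h) G"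
  shows "(LINT \<xi>|freq_measure h. complex_of_real (G (harmonic h 1 \<xi>)) * k \<xi>) = 0"
proof -
  let ?M = "freq_measure h" and ?S = "harmonic h 1 ` freq h"
  have S: "compact ?S"
    by (intro compact_continuous_image continuous_on_harmonic) (simp add: freq_def)
  have int_k: "integrable ?M k"
    using k by (simp add: null_coeffs_def)
  have Gc: "continuous_on (freq h) (\<lambda>\<xi>. G (harmonic h 1 \<xi>))"
    by (rule continuous_on_compose2[OF G continuous_on_harmonic]) simp
  have "bounded (G ` ?S)"
    by (intro compact_imp_bounded compact_continuous_image G S)
  then obtain B where B: "\<And>z. z \<in> ?S \<Longrightarrow> \<bar>G z\<bar> \<le> B"
    by (auto simp: bounded_iff)
  have int_G: "integrable ?M (\<lambda>\<xi>. complex_of_real (G (harmonic h 1 \<xi>)) * k \<xi>)"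
    by (rule integrable_bounded_mult[OF int_k continuous_imp_measurable_freq[OF Gc], of B])
       (auto intro: B)
  let ?I = "LINT \<xi>|?M. complex_of_real (G (harmonic h 1 \<xi>)) * k \<xi>"
  let ?K = "LINT \<xi>|?M. norm (k \<xi>)"
  have le: "norm ?I \<le> e * ?K" if e: "0 < e" for e
  proof -
    obtain p where p: "real_polynomial_function p" "\<And>z. z \<in> ?S \<Longrightarrow> \<bar>G z - p z\<bar> < e"
      using Stone_Weierstrass_real_polynomial_function[OF S G e] by blast
    have np: "null_coeffs h (\<lambda>\<xi>. complex_of_real (p (harmonic h 1 \<xi>)) * k \<xi>)"
      by (rule null_coeffs_polynomial[OF p(1) k])
    then have int_p: "integrable ?M (\<lambda>\<xi>. complex_of_real (p (harmonic h 1 \<xi>)) * k \<xi>)"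
      by (simp add: null_coeffs_def)
    \<comment> \<open>The coefficient of index 0 is the integral itself.\<close>
    have "(LINT \<xi>|?M. harmonic h 0 \<xi> * (complex_of_real (p (harmonic h 1 \<xi>)) * k \<xi>)) = 0"
      using np unfolding null_coeffs_def by blast
    then have "?I = (LINT \<xi>|?M. complex_of_real (G (harmonic h 1 \<xi>)) * k \<xi> - complex_of_real (p (harmonic h 1 \<xi>)) * k \<xi>)"
      using int_G int_p by simp
    also have "norm \<dots> \<le> (LINT \<xi>|?M. e * norm (k \<xi>))"
    proof (rule Bochner_Integration.integral_norm_bound_integral)
      fix \<xi> assume "\<xi> \<in> space ?M"
      then have "\<bar>G (harmonic h 1 \<xi>) - p (harmonic h 1 \<xi>)\<bar> * norm (k \<xi>) \<le> e * norm (k \<xi>)"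
        by (intro mult_right_mono less_imp_le[OF p(2)]) auto
      then show "norm (complex_of_real (G (harmonic h 1 \<xi>)) * k \<xi> - complex_of_real (p (harmonic h 1 \<xi>)) * k \<xi>) \<le> e * norm (k \<xi>)"
        by (simp add: norm_mult flip: left_diff_distrib of_real_diff)
    qed (use int_G int_p int_k in auto)
    finally show ?thesis by simp
  qed
  have "((\<lambda>e. e * ?K) \<longlongrightarrow> 0 * ?K) (at_right 0)"
    by (intro tendsto_intros)
  then have "norm ?I \<le> 0 * ?K"
    by (rule tendsto_lowerbound) (auto simp: le intro: eventually_at_right_less[THEN eventually_mono])
  then show ?thesis by simp
qed

text \<open>The angles differ by a multiple of \<open>2 * pi\<close>, and both lie between
  \<open>-pi\<close> and \<open>pi\<close>; hence the multiple is -1, 0 or 1, and a nonzero one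
  forces opposite endpoints.\<close>

lemma harmonic_1_eq_imp:
  assumes "0 < h" "\<xi> \<in> freq h" "\<eta> \<in> freq h" "harmonic h 1 \<xi> = harmonic h 1 \<eta>"
  shows "\<xi> = \<eta> \<or> {\<xi>, \<eta>} = {- (pi / h), pi / h}"
proof -
  have "sin (\<xi> * h) = sin (\<eta> * h) \<and> cos (\<xi> * h) = cos (\<eta> * h)"
    using assms(4) by (simp add: harmonic_def complex_eq_iff)
  then obtain n :: int where n: "\<xi> * h = \<eta> * h + 2 * pi * n"
    by (auto simp: sin_cos_eq_iff)
  have b: "- pi \<le> \<xi> * h" "\<xi> * h \<le> pi" "- pi \<le> \<eta> * h" "\<eta> * h \<le> pi"
    using assms by (auto simp: freq_def field_simps)
  have "2 * pi * n \<le> 2 * pi * 1" "2 * pi * (-1) \<le> 2 * pi * n"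
    using n b by linarith+
  then have "real_of_int n \<le> 1" "-1 \<le> real_of_int n"
    by (simp_all only: mult_le_cancel_left_pos[of "2 * pi"] pi_gt_zero zero_less_mult_iff zero_less_numeral simp_thms)
  then have "n = -1 \<or> n = 0 \<or> n = 1"
    by linarith
  then show ?thesis
  proof (elim disjE)
    assume "n = 0"
    then show ?thesis using n assms(1) by simp
  next
    assume "n = 1"
    then have "\<xi> * h = pi" "\<eta> * h = - pi" using n b by simp_all
    then have "\<xi> = pi / h" "\<eta> = - (pi / h)" using assms(1) by (simp_all add: field_simps)
    then show ?thesis by auto
  next
    assume "n = -1"
    then have "\<eta> * h = pi" "\<xi> * h = - pi" using n b by simp_all
    then have "\<eta> = pi / h" "\<xi> = - (pi / h)" using assms(1) by (simp_all add: field_simps)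
    then show ?thesis by auto
  qed
qed

text \<open>Wrapping the interval onto the circle identifies only the endpoints, so a continuous
  function with equal end values descends to a continuous function on the circle.\<close>

lemma null_coeffs_continuous_periodic:
  fixes u :: "real \<Rightarrow> real"
  assumes h: "0 < h" and k: "null_coeffs h k"
    and u: "continuous_on (freq h) u" "u (- (pi / h)) = u (pi / h)"
  shows "(LINT \<xi>|freq_measure h. complex_of_real (u \<xi>) * k \<xi>) = 0"
proof -
  let ?S = "harmonic h 1 ` freq h"
  \<comment> \<open>A continuous surjection from a compact space to a Hausdorff space is a quotient
    map.\<close>
  have q: "quotient_map (top_of_set (freq h)) (top_of_set ?S) (harmonic h 1)"
    by (rule continuous_imp_quotient_map)
       (auto simp: continuous_on_harmonic compact_space_subtopology Hausdorff_space_subtopology freq_def)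
  have c: "continuous_map (top_of_set (freq h)) euclidean u"
    using u by simp
  have e: "u x = u y"
    if "x \<in> topspace (top_of_set (freq h))" "y \<in> topspace (top_of_set (freq h))"
      "harmonic h 1 x = harmonic h 1 y" for x y
    using harmonic_1_eq_imp[OF h, of x y] that u(2) by (auto simp: doubleton_eq_iff)
  obtain G where "continuous_map (top_of_set ?S) euclidean G"
    and "G ` topspace (top_of_set ?S) = u ` topspace (top_of_set (freq h))"
    and G: "\<And>x. x \<in> topspace (top_of_set (freq h)) \<Longrightarrow> G (harmonic h 1 x) = u x"
    by (rule quotient_map_lift_exists[OF q c]) (use e that in blast)+
  then have "continuous_on ?S G" by simp
  from null_coeffs_continuous_on_circle[OF k this] show ?thesis
    by (rule trans[rotated], intro Bochner_Integration.integral_cong) (auto simp: G)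
qed

text \<open>A measurable function is an almost everywhere limit of continuous ones. Clamping these
  to the range from -1 to 1 makes the modulus of \<open>k\<close> an integrable majorant.\<close>

lemma null_coeffs_bounded_measurable:
  fixes f :: "real \<Rightarrow> real"
  assumes h: "0 < h" and k: "null_coeffs h k"
    and f [measurable]: "f \<in> borel_measurable (freq_measure h)" and f_le: "\<And>\<xi>. \<bar>f \<xi>\<bar> \<le> 1"
  shows "(LINT \<xi>|freq_measure h. complex_of_real (f \<xi>) * k \<xi>) = 0"
proof -
  let ?M = "freq_measure h"
  have int_k: "integrable ?M k"
    using k by (simp add: null_coeffs_def)
  then have [measurable]: "k \<in> borel_measurable ?M" by simp
  have "f measurable_on freq h"
    by (simp add: measurable_on_iff_borel_measurable)
  then obtain N g where N: "negligible N" and g: "\<And>n. continuous_on UNIV (g n)"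
    and lim: "\<And>x. x \<notin> N \<Longrightarrow> (\<lambda>n. g n x) \<longlonglongrightarrow> (if x \<in> freq h then f x else 0)"
    unfolding measurable_on_def by blast
  \<comment> \<open>The second factor vanishes at both ends of the interval, which makes \<open>u n\<close> periodic.\<close>
  define u where "u n \<xi> = max (-1) (min 1 (g n \<xi>)) * min 1 (real n * (pi / h - \<bar>\<xi>\<bar>))" for n :: nat and \<xi>
  have u_cont: "continuous_on (freq h) (u n)" for n
    unfolding u_def by (intro continuous_intros continuous_on_subset[OF g]) auto
  have [measurable]: "u n \<in> borel_measurable ?M" for n
    by (rule continuous_imp_measurable_freq[OF u_cont])
  have u_le: "\<bar>u n \<xi>\<bar> \<le> 1" if "\<xi> \<in> freq h" for n \<xi>
  proof -
    have "0 \<le> pi / h - \<bar>\<xi>\<bar>"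
      using that by (auto simp: freq_def)
    then show ?thesis
      unfolding u_def abs_mult by (intro mult_le_one) auto
  qed
  have "(LINT \<xi>|?M. complex_of_real (u n \<xi>) * k \<xi>) = 0" for n
    by (rule null_coeffs_continuous_periodic[OF h k u_cont]) (use h in \<open>simp add: u_def\<close>)
  moreover have "(\<lambda>n. LINT \<xi>|?M. complex_of_real (u n \<xi>) * k \<xi>) \<longlonglongrightarrow>
      (LINT \<xi>|?M. complex_of_real (f \<xi>) * k \<xi>)"
  proof (rule integral_dominated_convergence[where w = "\<lambda>\<xi>. norm (k \<xi>)"])
    \<comment> \<open>The endpoints join the exceptional set because every \<open>u n\<close>
      vanishes there.\<close>
    have "negligible (N \<union> {- (pi / h), pi / h})"
      using N by (simp add: negligible_Un)
    then have "AE \<xi> in lebesgue. \<xi> \<notin> N \<union> {- (pi / h), pi / h}"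
      by (intro AE_not_in) (simp only: negligible_iff_null_sets)
    then have "AE \<xi> in ?M. \<xi> \<notin> N \<union> {- (pi / h), pi / h}"
      by (subst AE_restrict_space_iff) (simp, erule eventually_mono, blast)
    moreover have "AE \<xi> in ?M. \<xi> \<in> freq h"
      by (rule AE_I2) simp
    ultimately show "AE \<xi> in ?M. (\<lambda>n. complex_of_real (u n \<xi>) * k \<xi>) \<longlonglongrightarrow> complex_of_real (f \<xi>) * k \<xi>"
    proof eventually_elim
      case (elim \<xi>)
      then have pos: "0 < pi / h - \<bar>\<xi>\<bar>"
        by (auto simp: freq_def abs_if)
      have "filterlim (\<lambda>n. real n * (pi / h - \<bar>\<xi>\<bar>)) at_top sequentially"
        using pos by (rule filterlim_at_top_mult_tendsto_pos[OF tendsto_const _ filterlim_real_sequentially])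
      then have "\<forall>\<^sub>F n in sequentially. 1 \<le> real n * (pi / h - \<bar>\<xi>\<bar>)"
        by (simp add: filterlim_at_top)
      then have "(\<lambda>n. min 1 (real n * (pi / h - \<bar>\<xi>\<bar>))) \<longlonglongrightarrow> 1"
        by (intro tendsto_eventually) (auto elim: eventually_mono)
      moreover have "(\<lambda>n. max (-1) (min 1 (g n \<xi>))) \<longlonglongrightarrow> max (-1) (min 1 (f \<xi>))"
        using lim[of \<xi>] elim by (intro tendsto_intros) auto
      ultimately have "(\<lambda>n. u n \<xi>) \<longlonglongrightarrow> max (-1) (min 1 (f \<xi>)) * 1"
        unfolding u_def by (intro tendsto_mult)
      moreover have "max (-1) (min 1 (f \<xi>)) = f \<xi>"
        using f_le[of \<xi>] by (simp add: abs_le_iff)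
      ultimately show ?case
        by (intro tendsto_intros) simp
    qed
    show "AE \<xi> in ?M. norm (complex_of_real (u n \<xi>) * k \<xi>) \<le> norm (k \<xi>)" for n
      by (intro AE_I2) (simp add: norm_mult mult_left_le_one_le u_le)
  qed (use int_k in auto)
  ultimately show ?thesis
    by (simp add: LIMSEQ_const_iff)
qed

theorem null_coeffs_imp_AE_0:
  assumes h: "0 < h" and k: "null_coeffs h k"
  shows "AE \<xi> in freq_measure h. k \<xi> = 0"
proof -
  let ?M = "freq_measure h"
  have int_k: "integrable ?M k"
    using k by (simp add: null_coeffs_def)
  then have [measurable]: "k \<in> borel_measurable ?M" by simp
  have int_s: "integrable ?M (\<lambda>\<xi>. complex_of_real (sgn (f \<xi>)) * k \<xi>)"
    if [measurable]: "f \<in> borel_measurable ?M" for f :: "real \<Rightarrow> real"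
    by (rule integrable_bounded_mult[OF int_k, where B = 1]) (auto simp: sgn_if)
  have int_0: "(LINT \<xi>|?M. complex_of_real (sgn (f \<xi>)) * k \<xi>) = 0"
    if [measurable]: "f \<in> borel_measurable ?M" for f :: "real \<Rightarrow> real"
    by (rule null_coeffs_bounded_measurable[OF h k]) (auto simp: sgn_if)
  \<comment> \<open>The sign of the real part is a bounded measurable test function that turns the
    real part into its absolute value.\<close>
  have "(LINT \<xi>|?M. \<bar>Re (k \<xi>)\<bar>) = Re (LINT \<xi>|?M. complex_of_real (sgn (Re (k \<xi>))) * k \<xi>)"
    by (subst integral_Re[symmetric], rule int_s) (simp_all add: abs_sgn mult.commute)
  then have "(LINT \<xi>|?M. \<bar>Re (k \<xi>)\<bar>) = 0"
    by (simp add: int_0)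
  then have Re: "AE \<xi> in ?M. \<bar>Re (k \<xi>)\<bar> = 0"
    using int_k by (subst (asm) integral_nonneg_eq_0_iff_AE) auto
  have "(LINT \<xi>|?M. \<bar>Im (k \<xi>)\<bar>) = Im (LINT \<xi>|?M. complex_of_real (sgn (Im (k \<xi>))) * k \<xi>)"
    by (subst integral_Im[symmetric], rule int_s) (simp_all add: abs_sgn mult.commute)
  then have "(LINT \<xi>|?M. \<bar>Im (k \<xi>)\<bar>) = 0"
    by (simp add: int_0)
  then have "AE \<xi> in ?M. \<bar>Im (k \<xi>)\<bar> = 0"
    using int_k by (subst (asm) integral_nonneg_eq_0_iff_AE) auto
  with Re show ?thesis
    by eventually_elim (simp add: complex_eq_iff)
qed

section \<open>Bounding a function by its Fourier coefficients\<close>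

lemma L2_norm_dft_partial_le:
  assumes "0 < h"
  shows "L2_norm h (dft_partial h v N) \<le> l2_norm h v"
proof -
  have "(L2_norm h (dft_partial h v N))\<^sup>2 = ennreal (h * (\<Sum>n\<in>{-int N..int N}. (cmod (v n))\<^sup>2))"
    unfolding dft_partial_eq[abs_def] by (rule L2_norm_trig_polynomial[OF assms]) simp
  also have "\<dots> = ennreal h * (\<Sum>n\<in>{-int N..int N}. ennreal ((cmod (v n))\<^sup>2))"
    using assms by (simp add: ennreal_mult sum_nonneg sum_ennreal)
  also have "\<dots> \<le> ennreal h * (\<Sum>\<^sub>\<infinity>n. ennreal ((cmod (v n))\<^sup>2))"
    by (subst nonneg_infsum_complete) (auto intro!: mult_left_mono SUP_upper)
  also have "\<dots> = (l2_norm h v)\<^sup>2"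
    by (simp add: l2_norm_power2)
  finally show ?thesis
    by (simp only: power2_le_iff_ennreal)
qed

text \<open>If the coefficients are not square-summable, the right side is infinite. Otherwise their
  transform \<open>g\<close> has the same coefficients as \<open>f\<close>, hence equals it almost
  everywhere, and \<open>g\<close> inherits the norm bound from the partial sums.\<close>

theorem L2_norm_le_l2_norm_inverse_dft:
  assumes h: "0 < h" and f: "integrable (freq_measure h) f"
  shows "L2_norm h f \<le> l2_norm h (inverse_dft h f)"
proof (cases "inverse_dft h f \<in> l2_space h")
  case False
  then show ?thesis
    by (simp add: l2_space_def not_less top_unique)
next
  case True
  let ?M = "freq_measure h" and ?c = "inverse_dft h f"
  define g where "g = dft h ?c"
  have dft: "is_dft h ?c g"
    unfolding g_def by (rule is_dft_dft[OF h True])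
  then have [measurable]: "g \<in> borel_measurable ?M" and fin: "L2_norm h g < \<infinity>"
    and lim: "(\<lambda>N. L2_norm h (\<lambda>\<xi>. g \<xi> - dft_partial h ?c N \<xi>)) \<longlonglongrightarrow> 0"
    by (auto simp: is_dft_def)
  have int_g: "integrable ?M g"
    by (rule L2_imp_integrable[OF h _ fin]) measurable
  have "inverse_dft h (\<lambda>\<xi>. f \<xi> - g \<xi>) n = 0" for n
    by (simp add: inverse_dft_diff f int_g inverse_dft_is_dft[OF h dft])
  then have "null_coeffs h (\<lambda>\<xi>. f \<xi> - g \<xi>)"
    using f int_g by (auto simp: null_coeffs_def inverse_dft_eq)
  then have "AE \<xi> in ?M. f \<xi> - g \<xi> = 0"
    by (rule null_coeffs_imp_AE_0[OF h])
  then have "L2_norm h f \<le> L2_norm h g"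
    unfolding L2_norm_eq_eL2 by (intro eL2_mono_AE) auto
  also have "\<dots> \<le> l2_norm h ?c"
  proof -
    \<comment> \<open>The bound holds for all \<open>N\<close>, and its first term tends to
      0.\<close>
    have "L2_norm h g \<le> L2_norm h (\<lambda>\<xi>. g \<xi> - dft_partial h ?c N \<xi>) + l2_norm h ?c" for N
    proof -
      have "L2_norm h g \<le> eL2 ?M (\<lambda>\<xi>. ennreal (cmod (g \<xi> - dft_partial h ?c N \<xi>)) + ennreal (cmod (dft_partial h ?c N \<xi>)))"
        unfolding L2_norm_eq_eL2
        by (intro eL2_mono) (auto simp flip: ennreal_plus intro!: ennreal_leI norm_triangle_sub simp: add.commute)
      also have "\<dots> \<le> L2_norm h (\<lambda>\<xi>. g \<xi> - dft_partial h ?c N \<xi>) + L2_norm h (dft_partial h ?c N)"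
        unfolding L2_norm_eq_eL2 by (intro eL2_add_le) auto
      finally show ?thesis
        by (rule order_trans) (intro add_left_mono L2_norm_dft_partial_le h)
    qed
    moreover have "(\<lambda>N. L2_norm h (\<lambda>\<xi>. g \<xi> - dft_partial h ?c N \<xi>) + l2_norm h ?c) \<longlonglongrightarrow> 0 + l2_norm h ?c"
      by (intro tendsto_add lim tendsto_const)
    ultimately have "L2_norm h g \<le> 0 + l2_norm h ?c"
      by (intro tendsto_lowerbound[where F = sequentially]) auto
    then show ?thesis by simp
  qed
  finally show ?thesis .
qed

subsection \<open>Dyadic pieces\<close>

lemma abs_sin_ge_half:
  assumes "\<bar>x\<bar> \<le> pi / 2"
  shows "\<bar>x\<bar> / 2 \<le> \<bar>sin x\<bar>"
proof -
  \<comment> \<open>The Taylor polynomial below order 3 is \<open>x\<close>, so the remainder is at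
    most a sixth of the cubed modulus of \<open>x\<close>.\<close>
  have "(\<Sum>m<3. sin_coeff m * x ^ m) = x"
    by (simp add: sin_coeff_def eval_nat_numeral)
  moreover have "fact 3 = (6 :: real)"
    by (simp add: eval_nat_numeral)
  ultimately have "\<bar>sin x - x\<bar> \<le> \<bar>x\<bar> ^ 3 / 6"
    using Maclaurin_sin_bound[of x 3] by (simp only: divide_inverse mult.commute)
  also have "\<bar>x\<bar> ^ 3 / 6 = \<bar>x\<bar> * (\<bar>x\<bar>\<^sup>2 / 6)"
    by (simp add: eval_nat_numeral)
  also have "\<dots> \<le> \<bar>x\<bar> * (1 / 2)"
  proof (rule mult_left_mono)
    \<comment> \<open>The value 1.6 exceeds \<open>pi / 2\<close>, and its square 2.56 is below
      3.\<close>
    have "\<bar>x\<bar> \<le> 1.6"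
      using assms pi_less_4 pi_approx by simp
    then have "\<bar>x\<bar>\<^sup>2 \<le> 1.6\<^sup>2"
      by (intro power_mono) auto
    then show "\<bar>x\<bar>\<^sup>2 / 6 \<le> 1 / 2"
      by (simp add: power2_eq_square)
  qed simp
  finally show ?thesis by (simp add: abs_if split: if_splits)
qed

lemma abs_sin_le_imp:
  assumes "\<bar>x\<bar> \<le> pi" "\<bar>sin x\<bar> \<le> e"
  shows "\<bar>x\<bar> \<le> 2 * e \<or> pi - 2 * e \<le> \<bar>x\<bar>"
proof (cases "\<bar>x\<bar> \<le> pi / 2")
  case True
  then show ?thesis
    using abs_sin_ge_half[of x] assms(2) by simp
next
  case False
  have "\<bar>sin (pi - \<bar>x\<bar>)\<bar> = \<bar>sin x\<bar>"
    by (simp add: abs_if)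
  then show ?thesis
    using abs_sin_ge_half[of "pi - \<bar>x\<bar>"] assms False by simp
qed

text \<open>Neighbourhoods of the three zeros of \<open>sin (\<xi> * h)\<close> in
  \<open>freq h\<close>, one-sided at the ends. The width \<open>b\<close> is measured in
  \<open>\<xi>\<close>, not in the angle.\<close>

definition near_zeros :: "real \<Rightarrow> real \<Rightarrow> real set" where
  "near_zeros h b = {-b..b} \<union> {-(pi / h)..-(pi / h) + b} \<union> {pi / h - b..pi / h}"

text \<open>The angle lies within \<open>2 * b * h\<close> of a zero of the sine; dividing by
  \<open>h\<close> leaves a width independent of \<open>h\<close>, the source of uniformity in the
  supremum bound.\<close>

lemma abs_sin_le_imp_near_zeros:
  assumes "0 < h" "\<xi> \<in> freq h" "\<bar>sin (\<xi> * h) / h\<bar> \<le> b"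
  shows "\<xi> \<in> near_zeros h (2 * b)"
proof -
  have "\<bar>\<xi> * h\<bar> \<le> pi"
    using assms by (auto simp: freq_def field_simps abs_le_iff)
  moreover have "\<bar>sin (\<xi> * h)\<bar> \<le> b * h"
    using assms by (simp add: abs_divide field_simps)
  ultimately have "\<bar>\<xi> * h\<bar> \<le> 2 * (b * h) \<or> pi - 2 * (b * h) \<le> \<bar>\<xi> * h\<bar>"
    by (rule abs_sin_le_imp)
  then have "\<bar>\<xi>\<bar> \<le> 2 * b \<or> pi / h - 2 * b \<le> \<bar>\<xi>\<bar>"
    using assms(1) by (simp add: abs_mult field_simps)
  then show ?thesis
    using assms(2) by (auto simp: near_zeros_def freq_def abs_if split: if_splits)
qed


lemma near_zeros_lebesgue [simp]: "near_zeros h b \<in> sets lebesgue"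
  unfolding near_zeros_def by (intro sets.Un) auto

lemma emeasure_near_zeros_le:
  assumes "0 \<le> b"
  shows "emeasure lebesgue (near_zeros h b) \<le> ennreal (4 * b)"
proof -
  have "emeasure lebesgue (near_zeros h b) \<le>
      emeasure lebesgue {-b..b} + emeasure lebesgue {-(pi / h)..-(pi / h) + b} + emeasure lebesgue {pi / h - b..pi / h}"
    unfolding near_zeros_def
    by (intro order_trans[OF emeasure_subadditive] add_right_mono) auto
  also have "\<dots> = ennreal (4 * b)"
    using assms by (simp flip: ennreal_plus)
  finally show ?thesis .
qed

lemma eL2_indicator_near_zeros:
  assumes "0 \<le> b"
  shows "eL2 (freq_measure h) (indicator (near_zeros h b \<inter> freq h)) \<le> ennreal (sqrt (4 * b))"
proof -
  let ?A = "near_zeros h b \<inter> freq h"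
  have A: "?A \<in> sets lebesgue"
    by (intro sets.Int) simp_all
  have "(eL2 (freq_measure h) (indicator ?A))\<^sup>2 = (\<integral>\<^sup>+\<xi>. indicator ?A \<xi> \<partial>freq_measure h)"
    unfolding eL2_power2 by (intro nn_integral_cong) (auto simp: indicator_def)
  also have "\<dots> = emeasure (freq_measure h) ?A"
    using A by (intro nn_integral_indicator) (simp add: sets_restrict_space_iff)
  also have "\<dots> = emeasure lebesgue ?A"
    using A by (intro emeasure_restrict_space) auto
  also have "\<dots> \<le> emeasure lebesgue (near_zeros h b)"
    by (intro emeasure_mono) auto
  also have "\<dots> \<le> ennreal (4 * b)"
    by (rule emeasure_near_zeros_le[OF assms])
  also have "\<dots> = (ennreal (sqrt (4 * b)))\<^sup>2"
    using assms by (simp add: ennreal_power)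
  finally show ?thesis
    by (simp only: power2_le_iff_ennreal)
qed

lemma AE_sin_nonzero:
  assumes "0 < h"
  shows "AE \<xi> in freq_measure h. sin (\<xi> * h) \<noteq> 0"
proof -
  have "AE \<xi> in lebesgue. \<xi> \<notin> {0, - (pi / h), pi / h}"
    by (intro AE_not_in) (simp flip: negligible_iff_null_sets)
  then have "AE \<xi> in freq_measure h. \<xi> \<notin> {0, - (pi / h), pi / h}"
    by (subst AE_restrict_space_iff) (simp, erule eventually_mono, blast)
  moreover have "AE \<xi> in freq_measure h. \<xi> \<in> freq h"
    by (rule AE_I2) simp
  ultimately show ?thesis
  proof eventually_elim
    case (elim \<xi>)
    then show ?case
      \<comment> \<open>For width 0 the neighbourhoods shrink to the three excluded points.\<close>
      using abs_sin_le_imp_near_zeros[OF assms, of \<xi> 0] by (auto simp: near_zeros_def)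
  qed
qed

text \<open>Reindexing by the naturals gives access to Minkowski's inequality and termwise
  integration for series.\<close>

lemma infsum_ennreal_int:
  fixes f :: "int \<Rightarrow> ennreal"
  shows "(\<Sum>\<^sub>\<infinity>j. f j) = (\<Sum>n. f (int_decode n))"
proof -
  have "(\<Sum>\<^sub>\<infinity>j. f j) = (\<Sum>\<^sub>\<infinity>n. f (int_decode n))"
    by (rule infsum_reindex_bij_betw[symmetric]) (rule bij_int_decode)
  also have "\<dots> = (\<Sum>n. f (int_decode n))"
    by (intro sums_unique has_sum_imp_sums has_sum_infsum nonneg_summable_on_complete) simp
  finally show ?thesis .
qed

section \<open>Pointwise properties of the dyadic partition\<close>

lemma dyadic_partition_suminf:
  assumes "dyadic_partition h \<phi>" "\<xi> \<in> freq h" "sin (\<xi> * h) \<noteq> 0"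
  shows "(\<Sum>n. ennreal (\<phi> (int_decode n) \<xi>)) = 1"
proof -
  have nonneg: "0 \<le> \<phi> j \<xi>" for j
    using assms unfolding dyadic_partition_def by auto
  have "((\<lambda>j. \<phi> j \<xi>) has_sum 1) UNIV"
    using assms unfolding dyadic_partition_def by blast
  then have "((\<lambda>n. \<phi> (int_decode n) \<xi>) has_sum 1) UNIV"
    by (subst has_sum_reindex_bij_betw[OF bij_int_decode])
  then have "(\<lambda>n. \<phi> (int_decode n) \<xi>) sums 1"
    by (rule has_sum_imp_sums)
  then have "(\<lambda>n. ennreal (\<phi> (int_decode n) \<xi>)) sums ennreal 1"
    by (subst sums_ennreal) (auto simp: nonneg)
  then show ?thesis
    by (simp add: sums_iff)
qed

lemma dyadic_partition_supp:
  assumes "dyadic_partition h \<phi>" "\<xi> \<in> freq h" "\<phi> j \<xi> \<noteq> 0"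
  shows "\<bar>sin (\<xi> * h) / h\<bar> \<in> {3 / 4 * 2 powi j..8 / 3 * 2 powi j}"
proof -
  have "\<xi> \<in> closure {\<xi> \<in> freq h. \<phi> j \<xi> \<noteq> 0}"
    using assms closure_subset by fastforce
  then have "\<xi> \<in> dyadic_shell h j"
    using assms unfolding dyadic_partition_def by blast
  then show ?thesis
    by (simp add: dyadic_shell_def power_int_add)
qed

text \<open>For nonnegative \<open>s\<close> the upper end of the shell is decisive, with factor
  8/3; for negative \<open>s\<close> the lower end is, with factor 4/3, which the larger base 8/3
  absorbs.\<close>

lemma powr_le_of_dyadic:
  fixes w s :: real
  assumes "w \<in> {3 / 4 * 2 powi j..8 / 3 * 2 powi j}"
  shows "w powr s \<le> (8 / 3) powr \<bar>s\<bar> * 2 powr (real_of_int j * s)"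
proof -
  define q where "q = (2::real) powi j"
  have q: "0 < q" "q powr s = 2 powr (real_of_int j * s)"
    by (simp_all add: q_def powr_powr flip: powr_real_of_int')
  have w: "3 / 4 * q \<le> w" "w \<le> 8 / 3 * q"
    using assms by (auto simp: q_def)
  then have "0 < w"
    using q(1) by linarith
  have "w powr s \<le> (8 / 3) powr \<bar>s\<bar> * q powr s"
  proof (cases "0 \<le> s")
    case True
    have "w powr s \<le> (8 / 3 * q) powr s"
      using True w \<open>0 < w\<close> by (intro powr_mono2) auto
    also have "\<dots> = (8 / 3) powr s * q powr s"
      by (rule powr_mult)
    finally show ?thesis
      using True by simp
  next
    case False
    then have "w powr s \<le> (3 / 4 * q) powr s"
      using w q by (intro powr_mono2') auto
    also have "\<dots> = (4 / 3) powr (- s) * q powr s"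
      using q by (simp add: powr_mult powr_minus powr_divide)
    also have "\<dots> \<le> (8 / 3) powr (- s) * q powr s"
      using False by (intro mult_right_mono powr_mono2) auto
    finally show ?thesis
      using False by simp
  qed
  then show ?thesis by (simp only: q)
qed

lemma dyadic_partition_measurable:
  "dyadic_partition h \<phi> \<Longrightarrow> \<phi> j \<in> borel_measurable (freq_measure h)"
  by (simp add: dyadic_partition_def)

lemma dyadic_partition_bounds:
  "dyadic_partition h \<phi> \<Longrightarrow> \<xi> \<in> freq h \<Longrightarrow> 0 \<le> \<phi> j \<xi> \<and> \<phi> j \<xi> \<le> 1"
  by (simp add: dyadic_partition_def)

lemma L2_norm_le_localization:
  assumes h: "0 < h" and \<phi>: "dyadic_partition h \<phi>" and v: "v \<in> l2_space h"
  shows "L2_norm h (\<lambda>\<xi>. dft h v \<xi> * complex_of_real (\<phi> j \<xi>)) \<le> l2_norm h (localization h \<phi> j v)"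
  unfolding localization_def
proof (rule L2_norm_le_l2_norm_inverse_dft[OF h])
  have [measurable]: "dft h v \<in> borel_measurable (freq_measure h)" and fin: "L2_norm h (dft h v) < \<infinity>"
    using is_dft_dft[OF h v] by (auto simp: is_dft_def)
  note [measurable] = dyadic_partition_measurable[OF \<phi>]
  have "integrable (freq_measure h) (\<lambda>\<xi>. complex_of_real (\<phi> j \<xi>) * dft h v \<xi>)"
    by (rule integrable_bounded_mult[OF L2_imp_integrable[OF h _ fin], where B = 1])
       (use dyadic_partition_bounds[OF \<phi>] in auto)
  then show "integrable (freq_measure h) (\<lambda>\<xi>. dft h v \<xi> * complex_of_real (\<phi> j \<xi>))"
    by (simp add: mult.commute)
qed

section \<open>The Sobolev bound\<close>

lemma sobolev_norm_le_besov_norm: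
  assumes h: "0 < h" and \<phi>: "dyadic_partition h \<phi>" and v: "v \<in> l2_space h"
  shows "sobolev_norm h s v \<le> ennreal ((8 / 3) powr \<bar>s\<bar>) * besov_norm h \<phi> s v"
proof -
  let ?M = "freq_measure h" and ?g = "dft h v" and ?C = "(8 / 3) powr \<bar>s\<bar>"
  let ?w = "\<lambda>\<xi>. \<bar>sin (\<xi> * h) / h\<bar> powr s"
  have [measurable]: "?g \<in> borel_measurable ?M"
    using is_dft_dft[OF h v] by (simp add: is_dft_def)
  note [measurable] = dyadic_partition_measurable[OF \<phi>]
  define F where "F j \<xi> = ennreal (?C * 2 powr (real_of_int j * s)) * ennreal (cmod (?g \<xi> * complex_of_real (\<phi> j \<xi>)))"
    for j \<xi>
  have "AE \<xi> in ?M. ennreal (cmod (?g \<xi> * complex_of_real (?w \<xi>))) \<le> (\<Sum>n. F (int_decode n) \<xi>)"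
    using AE_sin_nonzero[OF h] AE_space
  proof eventually_elim
    case (elim \<xi>)
    then have \<xi>: "\<xi> \<in> freq h" by simp
    have "ennreal (cmod (?g \<xi> * complex_of_real (?w \<xi>))) =
        ennreal (cmod (?g \<xi> * complex_of_real (?w \<xi>))) * (\<Sum>n. ennreal (\<phi> (int_decode n) \<xi>))"
      by (simp add: dyadic_partition_suminf[OF \<phi> \<xi> elim(1)])
    also have "\<dots> = (\<Sum>n. ennreal (cmod (?g \<xi> * complex_of_real (?w \<xi>))) * ennreal (\<phi> (int_decode n) \<xi>))"
      by (rule ennreal_suminf_cmult[symmetric])
    also have "\<dots> \<le> (\<Sum>n. F (int_decode n) \<xi>)"
    proof (intro suminf_le summableI)
      fix n
      let ?j = "int_decode n"
      have nonneg: "0 \<le> \<phi> ?j \<xi>"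
        using dyadic_partition_bounds[OF \<phi> \<xi>] by blast
      \<comment> \<open>The weight is controlled only on the shell; elsewhere both sides vanish with
        \<open>\<phi> ?j \<xi>\<close>.\<close>
      have "?w \<xi> * \<phi> ?j \<xi> \<le> ?C * 2 powr (real_of_int ?j * s) * \<phi> ?j \<xi>"
      proof (cases "\<phi> ?j \<xi> = 0")
        case False
        show ?thesis
          by (intro mult_right_mono powr_le_of_dyadic dyadic_partition_supp[OF \<phi> \<xi> False] nonneg)
      qed simp
      then have "cmod (?g \<xi>) * (?w \<xi> * \<phi> ?j \<xi>) \<le> cmod (?g \<xi>) * (?C * 2 powr (real_of_int ?j * s) * \<phi> ?j \<xi>)"
        by (rule mult_left_mono) simp
      then show "ennreal (cmod (?g \<xi> * complex_of_real (?w \<xi>))) * ennreal (\<phi> ?j \<xi>) \<le> F ?j \<xi>"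
        using nonneg by (simp add: F_def norm_mult mult_ac ennreal_leI flip: ennreal_mult)
    qed
    finally show ?case .
  qed
  then have "sobolev_norm h s v \<le> eL2 ?M (\<lambda>\<xi>. \<Sum>n. F (int_decode n) \<xi>)"
    unfolding sobolev_norm_def L2_norm_eq_eL2 by (rule eL2_mono_AE)
  also have "\<dots> \<le> (\<Sum>n. eL2 ?M (F (int_decode n)))"
    by (rule eL2_suminf_le) (simp add: F_def[abs_def])
  also have "\<dots> \<le> (\<Sum>n. ennreal ?C * (ennreal (2 powr (real_of_int (int_decode n) * s)) * l2_norm h (localization h \<phi> (int_decode n) v)))"
  proof (intro suminf_le summableI)
    fix n
    let ?j = "int_decode n"
    have "eL2 ?M (F ?j) = ennreal (?C * 2 powr (real_of_int ?j * s)) * L2_norm h (\<lambda>\<xi>. ?g \<xi> * complex_of_real (\<phi> ?j \<xi>))"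
      unfolding F_def[abs_def] L2_norm_eq_eL2 by (rule eL2_cmult) measurable
    also have "\<dots> \<le> ennreal (?C * 2 powr (real_of_int ?j * s)) * l2_norm h (localization h \<phi> ?j v)"
      by (intro mult_left_mono L2_norm_le_localization h \<phi> v) simp
    finally show "eL2 ?M (F ?j) \<le> ennreal ?C * (ennreal (2 powr (real_of_int ?j * s)) * l2_norm h (localization h \<phi> ?j v))"
      by (simp add: ennreal_mult mult.assoc)
  qed
  also have "\<dots> = ennreal ?C * besov_norm h \<phi> s v"
    by (simp add: besov_norm_def infsum_ennreal_int)
  finally show ?thesis .
qed

section \<open>The supremum bound\<close>

lemma nn_integral_shell_le:
  assumes h: "0 < h" and \<phi>: "dyadic_partition h \<phi>"
    and [measurable]: "g \<in> borel_measurable (freq_measure h)"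
  shows "(\<integral>\<^sup>+\<xi>. ennreal (cmod (g \<xi> * complex_of_real (\<phi> j \<xi>))) \<partial>freq_measure h)
    \<le> ennreal (5 * 2 powr (real_of_int j * (1/2))) * L2_norm h (\<lambda>\<xi>. g \<xi> * complex_of_real (\<phi> j \<xi>))"
proof -
  let ?M = "freq_measure h"
  note [measurable] = dyadic_partition_measurable[OF \<phi>]
  \<comment> \<open>The upper end of the shell; the piece then lives within \<open>2 * b\<close> of
    the zeros of the sine.\<close>
  define b where "b = 8 / 3 * (2::real) powi j"
  have b: "0 \<le> b" by (simp add: b_def)
  let ?A = "near_zeros h (2 * b) \<inter> freq h"
  have [measurable]: "?A \<in> sets ?M"
    by (simp add: sets_restrict_space_iff sets.Int)
  have supp: "\<xi> \<in> ?A" if "\<xi> \<in> freq h" "\<phi> j \<xi> \<noteq> 0" for \<xi>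
    using dyadic_partition_supp[OF \<phi> that] abs_sin_le_imp_near_zeros[OF h that(1), of b] that(1)
    by (simp add: b_def)
  have "(\<integral>\<^sup>+\<xi>. ennreal (cmod (g \<xi> * complex_of_real (\<phi> j \<xi>))) \<partial>?M) =
      (\<integral>\<^sup>+\<xi>. indicator ?A \<xi> * ennreal (cmod (g \<xi> * complex_of_real (\<phi> j \<xi>))) \<partial>?M)"
    using supp by (intro nn_integral_cong) (auto simp: indicator_def)
  also have "\<dots> \<le> eL2 ?M (indicator ?A) * L2_norm h (\<lambda>\<xi>. g \<xi> * complex_of_real (\<phi> j \<xi>))"
    unfolding L2_norm_eq_eL2 by (intro Cauchy_Schwarz_eL2) measurable
  also have "\<dots> \<le> ennreal (5 * 2 powr (real_of_int j * (1/2))) * L2_norm h (\<lambda>\<xi>. g \<xi> * complex_of_real (\<phi> j \<xi>))"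
  proof (rule mult_right_mono)
    \<comment> \<open>Here \<open>8 * b\<close> is \<open>64 / 3 * 2 powi j\<close>, and rounding
      64/3 up to the square 25 produces the constant 5.\<close>
    have "sqrt (4 * (2 * b)) \<le> sqrt (25 * 2 powi j)"
      by (simp add: b_def)
    also have "\<dots> = 5 * sqrt (2 powi j)"
      by (simp add: real_sqrt_mult)
    also have "sqrt (2 powi j) = 2 powr (real_of_int j * (1/2))"
      by (simp add: powr_half_sqrt[symmetric] powr_powr flip: powr_real_of_int')
    finally show "eL2 ?M (indicator ?A) \<le> ennreal (5 * 2 powr (real_of_int j * (1/2)))"
      using eL2_indicator_near_zeros[of "2 * b" h] b by (auto intro: order_trans ennreal_leI)
  qed simp
  finally show ?thesis .
qed

lemma linf_norm_le_besov_norm: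
  assumes h: "0 < h" and \<phi>: "dyadic_partition h \<phi>" and v: "v \<in> l2_space h"
  shows "linf_norm v \<le> ennreal 5 * besov_norm h \<phi> (1/2) v"
  unfolding linf_norm_def
proof (rule SUP_least)
  fix n
  let ?M = "freq_measure h" and ?g = "dft h v"
  have dft: "is_dft h v ?g"
    by (rule is_dft_dft[OF h v])
  then have [measurable]: "?g \<in> borel_measurable ?M"
    by (simp add: is_dft_def)
  note [measurable] = dyadic_partition_measurable[OF \<phi>]
  have "ennreal (cmod (v n)) = ennreal (cmod (inverse_dft h ?g n))"
    by (simp add: inverse_dft_is_dft[OF h dft])
  also have "\<dots> \<le> (\<integral>\<^sup>+\<xi>. ennreal (cmod (?g \<xi>)) \<partial>?M)"
    by (rule norm_inverse_dft_le)
  also have "\<dots> = (\<integral>\<^sup>+\<xi>. (\<Sum>i. ennreal (cmod (?g \<xi> * complex_of_real (\<phi> (int_decode i) \<xi>)))) \<partial>?M)"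
  proof (intro nn_integral_cong_AE, use AE_sin_nonzero[OF h] AE_space in eventually_elim)
    case (elim \<xi>)
    then have \<xi>: "\<xi> \<in> freq h" by simp
    have "ennreal (cmod (?g \<xi>)) = ennreal (cmod (?g \<xi>)) * (\<Sum>i. ennreal (\<phi> (int_decode i) \<xi>))"
      by (simp add: dyadic_partition_suminf[OF \<phi> \<xi> elim(1)])
    also have "\<dots> = (\<Sum>i. ennreal (cmod (?g \<xi>)) * ennreal (\<phi> (int_decode i) \<xi>))"
      by (rule ennreal_suminf_cmult[symmetric])
    \<comment> \<open>Nonnegativity of the partition functions lets them move inside the
      modulus.\<close>
    also have "\<dots> = (\<Sum>i. ennreal (cmod (?g \<xi> * complex_of_real (\<phi> (int_decode i) \<xi>))))"
      using dyadic_partition_bounds[OF \<phi> \<xi>] by (simp add: norm_mult ennreal_mult)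
    finally show ?case .
  qed
  also have "\<dots> = (\<Sum>i. \<integral>\<^sup>+\<xi>. ennreal (cmod (?g \<xi> * complex_of_real (\<phi> (int_decode i) \<xi>))) \<partial>?M)"
    by (rule nn_integral_suminf) measurable
  also have "\<dots> \<le> (\<Sum>i. ennreal 5 * (ennreal (2 powr (real_of_int (int_decode i) * (1/2))) * l2_norm h (localization h \<phi> (int_decode i) v)))"
  proof (intro suminf_le summableI)
    fix i
    let ?j = "int_decode i"
    have "(\<integral>\<^sup>+\<xi>. ennreal (cmod (?g \<xi> * complex_of_real (\<phi> ?j \<xi>))) \<partial>?M)
        \<le> ennreal (5 * 2 powr (real_of_int ?j * (1/2))) * L2_norm h (\<lambda>\<xi>. ?g \<xi> * complex_of_real (\<phi> ?j \<xi>))"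
      by (rule nn_integral_shell_le[OF h \<phi>]) measurable
    also have "\<dots> \<le> ennreal (5 * 2 powr (real_of_int ?j * (1/2))) * l2_norm h (localization h \<phi> ?j v)"
      by (intro mult_left_mono L2_norm_le_localization h \<phi> v) simp
    finally show "(\<integral>\<^sup>+\<xi>. ennreal (cmod (?g \<xi> * complex_of_real (\<phi> ?j \<xi>))) \<partial>?M)
        \<le> ennreal 5 * (ennreal (2 powr (real_of_int ?j * (1/2))) * l2_norm h (localization h \<phi> ?j v))"
      by (simp only: ennreal_mult' mult.assoc zero_le_numeral)
  qed
  also have "\<dots> = ennreal 5 * besov_norm h \<phi> (1/2) v"
    by (simp only: besov_norm_def infsum_ennreal_int ennreal_suminf_cmult)
  finally show "ennreal (cmod (v n)) \<le> ennreal 5 * besov_norm h \<phi> (1/2) v" .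
qed

theorem proposition2p4:
  shows "(\<forall>s::real. \<exists>C::real. C > 0 \<and>
            (\<forall>(h::real) \<phi>. h > 0 \<longrightarrow> dyadic_partition h \<phi> \<longrightarrow>
               (\<forall>v\<in>besov_space h \<phi> s. sobolev_norm h s v \<le> ennreal C * besov_norm h \<phi> s v)))
       \<and> (\<exists>C::real. C > 0 \<and>
            (\<forall>(h::real) \<phi>. h > 0 \<longrightarrow> dyadic_partition h \<phi> \<longrightarrow>
               (\<forall>v\<in>besov_space h \<phi> (1/2). linf_norm v \<le> ennreal C * besov_norm h \<phi> (1/2) v)))"
proof (intro conjI allI)
  fix s :: real
  show "\<exists>C::real. C > 0 \<and>
            (\<forall>(h::real) \<phi>. h > 0 \<longrightarrow> dyadic_partition h \<phi> \<longrightarrow>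
               (\<forall>v\<in>besov_space h \<phi> s. sobolev_norm h s v \<le> ennreal C * besov_norm h \<phi> s v))"
    by (intro exI[of _ "(8 / 3) powr \<bar>s\<bar>"])
       (auto simp: besov_space_def intro: sobolev_norm_le_besov_norm)
next
  show "\<exists>C::real. C > 0 \<and>
            (\<forall>(h::real) \<phi>. h > 0 \<longrightarrow> dyadic_partition h \<phi> \<longrightarrow>
               (\<forall>v\<in>besov_space h \<phi> (1/2). linf_norm v \<le> ennreal C * besov_norm h \<phi> (1/2) v))"
    by (intro exI[of _ 5]) (auto simp only: besov_space_def mem_Collect_eq intro!: linf_norm_le_besov_norm)
qed

end
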